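(* Let $p\in(1,\infty)$, let $q=\frac{p}{p-1}$, and let $c$ be defined by $2^{1/c}=p^{1/p}q^{1/q}$. For every $d\ge 1$ and all finitely supported $f,g,h:\mathbb{Z}^d\to[0,\infty)$ with $f$ supported on $\{0,1\}^d$, $$\|f\,\bar{*}\,g\,\bar{*}\,h\|_1\geq \|f\|_c\,\|g\|_p\,\|h\|_q.$$ In particular, for all finite $A,B\subset\mathbb{Z}^d$ and all $V\subseteq\{0,1\}^d$, $$|V+A+B|\geq |V|^{1/c}|A|^{1/p}|B|^{1/q}.$$
   Context: For $r>0$ and finitely supported $f:\mathbb{Z}^d\to\mathbb{R}$, $\|f\|_r=\left(\sum_{x\in\mathbb{Z}^d}|f(x)|^r\right)^{1/r}$. The sup-convolution of finitely supported $f,g:\mathbb{Z}^d\to\mathbb{R}$ is $f\bar{*}g(z)=\sup_{x\in\mathbb{Z}^d} f(x)g(z-x)$; $f\bar{*}g\bar{*}h$ means $(f\bar{*}g)\bar{*}h$. Sums of sets are Minkowski sums and $|\cdot|$ denotes cardinality. *)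

theory Defs
  imports "HOL-Analysis.Analysis" "HOL-Library.Set_Algebras"
begin

text \<open>
  The lattice of dimension \<open>d\<close> is \<open>int ^ 'd\<close>, with \<open>d = CARD('d)\<close> an arbitrary positive number.
  The sum of two sets is the Minkowski sum of \<open>HOL-Library.Set_Algebras\<close>.
\<close>

definition finitely_supported :: "('a \<Rightarrow> real) \<Rightarrow> bool" where
  "finitely_supported f \<longleftrightarrow> finite {x. f x \<noteq> 0}"

text \<open>
  Since \<open>0 powr r = 0\<close>, the terms outside the support vanish, so for a finitely supported
  function the infinite sum is a finite one.
\<close>

definition lr_norm :: "real \<Rightarrow> (int ^ 'd \<Rightarrow> real) \<Rightarrow> real" where
  "lr_norm r f = (\<Sum>\<^sub>\<infinity>x. \<bar>f x\<bar> powr r) powr (1 / r)"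

text \<open>
  The supremum is the one of the conditionally complete lattice of reals; for finitely supported
  \<open>f\<close> and \<open>g\<close> it is taken over a finite, hence bounded, set of values.
\<close>

definition sup_conv :: "(int ^ 'd \<Rightarrow> real) \<Rightarrow> (int ^ 'd \<Rightarrow> real) \<Rightarrow> int ^ 'd \<Rightarrow> real"
    (infixl "\<^bold>*" 70) where
  "(f \<^bold>* g) z = (SUP x. f x * g (z - x))"

definition cube01 :: "(int ^ 'd) set" where
  "cube01 = {x. \<forall>i. x $ i \<in> {0, 1}}"

end

theory Submission
  imports Defs
begin

text \<open>
  In dimension one let \<open>f\<close> take the values \<open>1\<close> and \<open>b < 1\<close>. Spreading \<open>g\<close> and \<open>h\<close> over unit
  cells with an exponential profile of ratio \<open>b\<close> reduces the claim to the continuous inequality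
  \<open>\<integral> T \<ge> \<integral> G\<^sup>p + \<integral> H\<^sup>q\<close> for \<open>G x * H y \<le> T (x + y)\<close> and \<open>max G = max H = 1\<close>, which
  follows from \<open>|A + B| \<ge> |A| + |B|\<close> on superlevel sets, and to the scalar inequality
  \<open>(1 - b\<^sup>p)\<^bsup>1/p\<^esup> (1 - b\<^sup>q)\<^bsup>1/q\<^esup> \<ge> (1 - b) (1 + b\<^sup>c)\<^bsup>1/c\<^esup>\<close>.
  The scalar inequality is sharp as \<open>b\<close> tends to \<open>0\<close> and to \<open>1\<close>. With \<open>b = exp (- 2 y)\<close>, the
  derivative in \<open>y\<close> of the logarithm of the ratio of its sides is
  \<open>coth (p y) + coth (q y) - coth y - tanh (c y)\<close>; once negative it stays negative, so the
  logarithm, which vanishes at both ends, is nonnegative.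
  The higher-dimensional case follows by slicing along one coordinate at a time.
\<close>

subsection \<open>The scalar inequality\<close>

text \<open>The one-sided sign pattern behind the scalar inequality: it survives positive factors
  and integration from 0, so it can be checked on derivatives and carried back.\<close>

definition stays_neg :: "(real \<Rightarrow> real) \<Rightarrow> bool" where
  "stays_neg f \<longleftrightarrow> (\<forall>x y. 0 < x \<longrightarrow> x < y \<longrightarrow> f x < 0 \<longrightarrow> f y < 0)"

lemma stays_neg_mult_pos:
  assumes "stays_neg f" "\<And>x. 0 < x \<Longrightarrow> 0 < k x"
  shows "stays_neg (\<lambda>x. f x * k x)"
  unfolding stays_neg_def
proof (intro allI impI)
  fix x y :: real assume "0 < x" "x < y" "f x * k x < 0"
  then have "f x < 0" "0 < k y" using assms(2)[of x] assms(2)[of y] by (auto simp: mult_less_0_iff)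
  then have "f y < 0" using assms(1) \<open>0 < x\<close> \<open>x < y\<close> unfolding stays_neg_def by blast
  then show "f y * k y < 0" using \<open>0 < k y\<close> by (simp add: mult_less_0_iff)
qed

text \<open>To get from the limit 0 down to \<open>F x < 0\<close>, \<open>F\<close> must have a
  negative slope somewhere before \<open>x\<close>; from there on the slope stays negative.\<close>

lemma stays_neg_antiderivative_decreasing:
  assumes f: "stays_neg f" and d: "\<And>x. 0 < x \<Longrightarrow> (F has_real_derivative f x) (at x)"
    and lim: "(F \<longlongrightarrow> 0) (at_right 0)" and "0 < x" "x < y" "F x < 0"
  shows "F y < F x"
proof -
  have "\<forall>\<^sub>F e in at_right 0. F x < F e" using order_tendstoD(1)[OF lim \<open>F x < 0\<close>] .
  moreover have "\<forall>\<^sub>F e in at_right 0. e < x" using eventually_at_right_less[of 0] \<open>0 < x\<close>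
    by (auto simp: eventually_at_right_field)
  moreover have "\<forall>\<^sub>F e::real in at_right 0. 0 < e" by (rule eventually_at_right_less)
  ultimately have "\<forall>\<^sub>F e in at_right 0. F x < F e \<and> e < x \<and> 0 < e" by eventually_elim auto
  \<comment> \<open>\<open>F 0\<close> is not tied to the limit, so the mean value theorem starts
    from some \<open>e\<close> near 0 with \<open>F e\<close> still above
    \<open>F x\<close>.\<close>
  then obtain e where e: "F x < F e" "e < x" "0 < e"
    using eventually_happens trivial_limit_at_right_real by fastforce
  obtain z where z: "e < z" "z < x" "F x - F e = (x - e) * f z"
    using MVT2[of e x F f] d e by (meson less_le_trans)
  then have "f z < 0" using e
    by (metis diff_gt_0_iff_gt diff_less_0_iff_less mult_less_0_iff order_less_not_sym)
  obtain w where w: "x < w" "w < y" "F y - F x = (y - x) * f w"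
    using MVT2[of x y F f] d \<open>0 < x\<close> \<open>x < y\<close> by (meson less_le_trans)
  have "f w < 0" using f \<open>f z < 0\<close> z w e unfolding stays_neg_def by (meson less_trans)
  then have "F y - F x < 0" using w \<open>x < y\<close> by (simp add: mult_pos_neg)
  then show ?thesis by simp
qed

lemma stays_neg_antiderivative:
  assumes "stays_neg f" "\<And>x. 0 < x \<Longrightarrow> (F has_real_derivative f x) (at x)"
    "(F \<longlongrightarrow> 0) (at_right 0)"
  shows "stays_neg F"
  unfolding stays_neg_def using stays_neg_antiderivative_decreasing[OF assms] by force

text \<open>Once negative, \<open>F\<close> keeps decreasing and stays below a negative constant, so
  it cannot tend to 0 at infinity.\<close>

lemma stays_neg_derivative_imp_nonneg:
  assumes "stays_neg f" "\<And>x. 0 < x \<Longrightarrow> (F has_real_derivative f x) (at x)"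
    "(F \<longlongrightarrow> 0) (at_right 0)" and top: "(F \<longlongrightarrow> 0) at_top" and "0 < x"
  shows "0 \<le> F x"
proof (rule ccontr)
  assume "\<not> 0 \<le> F x"
  then have "F y < F x" if "x < y" for y
    using stays_neg_antiderivative_decreasing[OF assms(1-3) \<open>0 < x\<close> that] by simp
  then have "\<forall>\<^sub>F y in at_top. F y \<le> F x"
    by (intro eventually_mono[OF eventually_gt_at_top[of x]]) (simp add: less_imp_le)
  then have "0 \<le> F x" using top by (intro tendsto_upperbound[OF top]) auto
  then show False using \<open>\<not> 0 \<le> F x\<close> by simp
qed

text \<open>The Wronskian of \<open>u\<close> with \<open>cosh (k x)\<close> has derivative \<open>v cosh (k x)\<close>.\<close>

lemma stays_neg_second_order:
  fixes k :: real
  assumes v: "stays_neg (\<lambda>x. u2 x - k\<^sup>2 * u x)"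
    and u: "\<And>x. (u has_real_derivative u1 x) (at x)"
    and u1: "\<And>x. (u1 has_real_derivative u2 x) (at x)"
    and "u 0 = 0" "u1 0 = 0"
  shows "stays_neg u"
proof -
  define w where "w x = u1 x * cosh (k * x) - u x * (k * sinh (k * x))" for x
  have dw: "(w has_real_derivative (u2 x - k\<^sup>2 * u x) * cosh (k * x)) (at x)" for x
    unfolding w_def
    by (auto intro!: derivative_eq_intros u u1 simp: algebra_simps power2_eq_square)
  have "w 0 = 0" unfolding w_def using assms by simp
  then have "(w \<longlongrightarrow> 0) (at_right 0)"
    using DERIV_isCont[OF dw[of 0]] by (metis isCont_def filterlim_at_split)
  then have w: "stays_neg w"
    by (intro stays_neg_antiderivative[OF stays_neg_mult_pos[OF v] dw]) auto
  \<comment> \<open>Dividing the Wronskian by the square of \<open>cosh (k * x)\<close> gives the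
    derivative of this quotient, so the sign pattern passes from \<open>w\<close> to
    \<open>r\<close> and then to \<open>u\<close>.\<close>
  define r where "r x = u x / cosh (k * x)" for x
  have dr: "(r has_real_derivative w x * (1 / (cosh (k * x))\<^sup>2)) (at x)" for x
    unfolding r_def w_def
    by (auto intro!: derivative_eq_intros u simp: algebra_simps power2_eq_square divide_simps)
  have "r 0 = 0" unfolding r_def using assms by simp
  then have "(r \<longlongrightarrow> 0) (at_right 0)"
    using DERIV_isCont[OF dr[of 0]] by (metis isCont_def filterlim_at_split)
  then have "stays_neg r"
    by (intro stays_neg_antiderivative[OF stays_neg_mult_pos[OF w] dr]) auto
  then have "stays_neg (\<lambda>x. r x * cosh (k * x))" by (rule stays_neg_mult_pos) simp
  then show ?thesis unfolding r_def by simp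
qed

section \<open>Sums of hyperbolic cosines\<close>

lemma cosh_mult_cosh: "cosh x * cosh y = (cosh (x + y) + cosh (x - y)) / (2::real)"
  by (simp add: cosh_add cosh_diff)

text \<open>After the product-to-sum formula, each argument on the left is at most its partner on
  the right in absolute value. This is monotonicity of \<open>cosh (b * x) / cosh (a * x)\<close>
  without division.\<close>

lemma cosh_ratio_antimono:
  fixes a b x y :: real
  assumes "0 \<le> b" "b \<le> a" "0 \<le> x" "x \<le> y"
  shows "cosh (b * y) * cosh (a * x) \<le> cosh (b * x) * cosh (a * y)"
proof -
  have "0 \<le> (a - b) * (y - x)" "0 \<le> (a - b) * (y + x)" "0 \<le> (a + b) * (y - x)" using assms by simp_all
  then have 1: "b * y + a * x \<le> b * x + a * y" "b * y - a * x \<le> a * y - b * x" "a * x - b * y \<le> a * y - b * x"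
    by (simp_all add: algebra_simps)
  have "0 \<le> a * x" "0 \<le> b * y" "0 \<le> b * x" "b * x \<le> a * y" using assms by (auto intro!: mult_mono)
  have "cosh (b * y + a * x) \<le> cosh (b * x + a * y)"
    using 1 \<open>0 \<le> a * x\<close> \<open>0 \<le> b * y\<close> by (intro cosh_real_nonneg_le_iff[THEN iffD2]) auto
  moreover have "cosh (b * y - a * x) \<le> cosh (b * x - a * y)"
  proof -
    have "cosh \<bar>b * y - a * x\<bar> \<le> cosh \<bar>b * x - a * y\<bar>"
      using 1 by (intro cosh_real_nonneg_le_iff[THEN iffD2]) auto
    then show ?thesis by simp
  qed
  ultimately show ?thesis unfolding cosh_mult_cosh by simp
qed

text \<open>Divided by the top-frequency term \<open>cosh (a * x)\<close>, the sum is a constant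
  plus two nonincreasing quotients, so it cannot return from negative values.\<close>

lemma stays_neg_three_cosh:
  fixes a b d :: real
  assumes "0 \<le> b" "b \<le> a" "0 \<le> d" "d \<le> a" "0 \<le> \<beta>" "0 \<le> \<gamma>"
  shows "stays_neg (\<lambda>x. - \<alpha> * cosh (a * x) + \<beta> * cosh (b * x) + \<gamma> * cosh (d * x))"
  unfolding stays_neg_def
proof (intro allI impI)
  fix x y :: real
  assume x: "0 < x" "x < y" and neg: "- \<alpha> * cosh (a * x) + \<beta> * cosh (b * x) + \<gamma> * cosh (d * x) < 0"
  have "(- \<alpha> * cosh (a * y) + \<beta> * cosh (b * y) + \<gamma> * cosh (d * y)) * cosh (a * x)
      = - \<alpha> * cosh (a * y) * cosh (a * x) + \<beta> * (cosh (b * y) * cosh (a * x)) + \<gamma> * (cosh (d * y) * cosh (a * x))"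
    by (simp add: algebra_simps)
  also have "\<dots> \<le> - \<alpha> * cosh (a * y) * cosh (a * x) + \<beta> * (cosh (b * x) * cosh (a * y)) + \<gamma> * (cosh (d * x) * cosh (a * y))"
    using assms x by (intro add_mono order_refl mult_left_mono[OF cosh_ratio_antimono]) auto
  also have "\<dots> = (- \<alpha> * cosh (a * x) + \<beta> * cosh (b * x) + \<gamma> * cosh (d * x)) * cosh (a * y)"
    by (simp add: algebra_simps)
  also have "\<dots> < 0" using neg by (intro mult_neg_pos) auto
  finally show "- \<alpha> * cosh (a * y) + \<beta> * cosh (b * y) + \<gamma> * cosh (d * y) < 0"
    using cosh_real_pos[of "a * x"] by (metis mult_less_0_iff order_less_asym)
qed

text \<open>Up to a positive factor, the derivative of the logarithm of the ratio of the two sides of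
  \<open>geometric_ratio_ineq\<close>; see \<open>coth_sum_eq\<close>. Applying \<open>u \<mapsto> u'' - F\<^sup>2 u\<close> and
  \<open>u \<mapsto> u'' - G\<^sup>2 u\<close> removes two of the five frequencies and leaves the signs needed
  for \<open>stays_neg_three_cosh\<close>.\<close>

lemma stays_neg_five_cosh:
  fixes p q c :: real
  assumes "1 < p" "p \<le> q" "p * q = p + q" "1 \<le> c" "c \<le> q"
  defines "m \<equiv> p + q" and "\<delta> \<equiv> q - p"
  shows "stays_neg (\<lambda>x. cosh ((m + 1 - c) * x) - cosh ((m + c - 1) * x) - 2 * cosh ((m - 1 - c) * x)
     + cosh ((\<delta> + 1 + c) * x) + cosh ((\<delta> - 1 - c) * x))" (is "stays_neg ?e")
proof -
  define A B C F G where "A = m + c - 1" "B = m + 1 - c" "C = \<delta> + 1 + c" "F = m - 1 - c" "G = \<delta> - 1 - c"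
  note defs = A_B_C_F_G_def
  \<comment> \<open>The smaller of two conjugate exponents:
    \<open>(p - 1) * (q - 1) = 1\<close>.\<close>
  have "p \<le> 2"
  proof -
    have "(p - 1) * (p - 1) \<le> (p - 1) * (q - 1)" using assms by (intro mult_left_mono) auto
    then have "(p - 1)\<^sup>2 \<le> 1\<^sup>2" using assms by (simp add: algebra_simps power2_eq_square)
    then have "p - 1 \<le> 1" by (rule power2_le_imp_le) simp
    then show ?thesis by simp
  qed
  \<comment> \<open>Factoring these differences of squares gives the signs of the coefficients left
    at \<open>B\<close> and \<open>C\<close> after both eliminations.\<close>
  have BF: "0 \<le> B\<^sup>2 - F\<^sup>2"
  proof -
    have "B\<^sup>2 - F\<^sup>2 = 4 * (m - c)" unfolding defs by (simp add: algebra_simps power2_eq_square)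
    then show ?thesis using assms by simp
  qed
  have BG: "0 \<le> B\<^sup>2 - G\<^sup>2"
  proof -
    have "B\<^sup>2 - G\<^sup>2 = (2 * p + 2) * (2 * q - 2 * c)" unfolding defs m_def \<delta>_def
      by (simp add: algebra_simps power2_eq_square)
    then show ?thesis using assms by simp
  qed
  have CF: "0 \<le> C\<^sup>2 - F\<^sup>2"
  proof -
    have "C\<^sup>2 - F\<^sup>2 = (2 + 2 * c - 2 * p) * (2 * q)" unfolding defs m_def \<delta>_def
      by (simp add: algebra_simps power2_eq_square)
    then show ?thesis using assms \<open>p \<le> 2\<close> by simp
  qed
  have CG: "0 \<le> C\<^sup>2 - G\<^sup>2"
  proof -
    have "C\<^sup>2 - G\<^sup>2 = 4 * \<delta> * (1 + c)" unfolding defs m_def \<delta>_def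
      by (simp add: algebra_simps power2_eq_square)
    then show ?thesis using assms by simp
  qed
  have ord: "0 \<le> B" "B \<le> A" "0 \<le> C" "C \<le> A" unfolding defs m_def \<delta>_def using assms \<open>p \<le> 2\<close> by auto
  \<comment> \<open>With \<open>e\<close> the goal function, this is \<open>e'' - F^2 e\<close>, so
    the frequency \<open>F\<close> is gone.\<close>
  define u where "u x = (B\<^sup>2 - F\<^sup>2) * cosh (B * x) - (A\<^sup>2 - F\<^sup>2) * cosh (A * x)
     + (C\<^sup>2 - F\<^sup>2) * cosh (C * x) + (G\<^sup>2 - F\<^sup>2) * cosh (G * x)" for x
  define u1 where "u1 x = (B\<^sup>2 - F\<^sup>2) * B * sinh (B * x) - (A\<^sup>2 - F\<^sup>2) * A * sinh (A * x)
     + (C\<^sup>2 - F\<^sup>2) * C * sinh (C * x) + (G\<^sup>2 - F\<^sup>2) * G * sinh (G * x)" for x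
  define u2 where "u2 x = (B\<^sup>2 - F\<^sup>2) * B\<^sup>2 * cosh (B * x) - (A\<^sup>2 - F\<^sup>2) * A\<^sup>2 * cosh (A * x)
     + (C\<^sup>2 - F\<^sup>2) * C\<^sup>2 * cosh (C * x) + (G\<^sup>2 - F\<^sup>2) * G\<^sup>2 * cosh (G * x)" for x
  define e1 where "e1 x = B * sinh (B * x) - A * sinh (A * x) - 2 * F * sinh (F * x)
     + C * sinh (C * x) + G * sinh (G * x)" for x
  define e2 where "e2 x = B\<^sup>2 * cosh (B * x) - A\<^sup>2 * cosh (A * x) - 2 * F\<^sup>2 * cosh (F * x)
     + C\<^sup>2 * cosh (C * x) + G\<^sup>2 * cosh (G * x)" for x
  have e: "?e = (\<lambda>x. cosh (B * x) - cosh (A * x) - 2 * cosh (F * x) + cosh (C * x) + cosh (G * x))"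
    unfolding defs by simp
  have v: "stays_neg (\<lambda>x. u2 x - G\<^sup>2 * u x)"
  proof -
    \<comment> \<open>Now \<open>G\<close> is gone as well; the coefficients at \<open>B\<close> and
      \<open>C\<close> are nonnegative, and \<open>A\<close> is the top frequency.\<close>
    have eq: "u2 x - G\<^sup>2 * u x = - ((A\<^sup>2 - F\<^sup>2) * (A\<^sup>2 - G\<^sup>2)) * cosh (A * x)
       + ((B\<^sup>2 - F\<^sup>2) * (B\<^sup>2 - G\<^sup>2)) * cosh (B * x) + ((C\<^sup>2 - F\<^sup>2) * (C\<^sup>2 - G\<^sup>2)) * cosh (C * x)" for x
      unfolding u2_def u_def by algebra
    show ?thesis unfolding eq using ord BF BG CF CG by (intro stays_neg_three_cosh) auto
  qed
  \<comment> \<open>The second derivative of the goal function vanishes at 0: the left side equals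
    \<open>8 * (p + q - p * q)\<close>, so this is conjugacy.\<close>
  have sumsq: "B\<^sup>2 - A\<^sup>2 - 2 * F\<^sup>2 + C\<^sup>2 + G\<^sup>2 = 0"
    unfolding defs m_def \<delta>_def using \<open>p * q = p + q\<close> by algebra
  have su: "stays_neg u"
  proof (rule stays_neg_second_order[OF v])
    show "(u has_real_derivative u1 x) (at x)" for x unfolding u_def u1_def
      by (auto intro!: derivative_eq_intros simp: algebra_simps)
    show "(u1 has_real_derivative u2 x) (at x)" for x unfolding u1_def u2_def
      by (auto intro!: derivative_eq_intros simp: algebra_simps power2_eq_square)
    show "u 0 = 0" unfolding u_def using sumsq by simp
    show "u1 0 = 0" unfolding u1_def by simp
  qed
  have ueq: "u = (\<lambda>x. e2 x - F\<^sup>2 * ?e x)"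
  proof
    fix x
    have "?e x = cosh (B * x) - cosh (A * x) - 2 * cosh (F * x) + cosh (C * x) + cosh (G * x)"
      unfolding defs by simp
    then show "u x = e2 x - F\<^sup>2 * ?e x" unfolding u_def e2_def by algebra
  qed
  show ?thesis
  proof (rule stays_neg_second_order[of e2 F _ e1])
    show "stays_neg (\<lambda>x. e2 x - F\<^sup>2 * ?e x)" using su ueq by simp
    show "(?e has_real_derivative e1 x) (at x)" for x unfolding e e1_def
      by (auto intro!: derivative_eq_intros simp: algebra_simps)
    show "(e1 has_real_derivative e2 x) (at x)" for x unfolding e1_def e2_def
      by (auto intro!: derivative_eq_intros simp: algebra_simps power2_eq_square)
    show "?e 0 = 0" by simp
    show "e1 0 = 0" unfolding e1_def by simp
  qed
qed

section \<open>The logarithm of the ratio of the two sides\<close>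

text \<open>Over the common denominator the numerator consists of fourfold products, which the
  addition formulas identify with the combination in \<open>stays_neg_five_cosh\<close>.\<close>

lemma coth_sum_eq:
  fixes p q c y :: real
  assumes "1 < p" "1 < q" "0 < y"
  shows "cosh (p * y) / sinh (p * y) + cosh (q * y) / sinh (q * y) - cosh y / sinh y - sinh (c * y) / cosh (c * y)
   = (cosh ((p + q + 1 - c) * y) - cosh ((p + q + c - 1) * y) - 2 * cosh ((p + q - 1 - c) * y)
     + cosh ((q - p + 1 + c) * y) + cosh ((q - p - 1 - c) * y))
     * (1 / (4 * sinh (p * y) * sinh (q * y) * sinh y * cosh (c * y)))"
proof -
  have pos: "0 < sinh (p * y)" "0 < sinh (q * y)" "0 < sinh y" "0 < cosh (c * y)" using assms by auto
  define E where "E = cosh ((p + q + 1 - c) * y) - cosh ((p + q + c - 1) * y) - 2 * cosh ((p + q - 1 - c) * y)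
     + cosh ((q - p + 1 + c) * y) + cosh ((q - p - 1 - c) * y)"
  have "E = cosh (p*y + q*y + y - c*y) - cosh (p*y + q*y + c*y - y) - 2 * cosh (p*y + q*y - y - c*y)
     + cosh (q*y - p*y + y + c*y) + cosh (q*y - p*y - y - c*y)"
    unfolding E_def by (simp add: algebra_simps)
  also have "\<dots> = 4 * (cosh (p * y) * sinh (q * y) * sinh y * cosh (c * y) + cosh (q * y) * sinh (p * y) * sinh y * cosh (c * y)
     - cosh y * sinh (p * y) * sinh (q * y) * cosh (c * y) - sinh (c * y) * sinh (p * y) * sinh (q * y) * sinh y)"
    by (simp add: cosh_add cosh_diff sinh_add sinh_diff algebra_simps)
  finally have E: "E = \<dots>" .
  have "C1 / s1 + C2 / s2 - C / s - S / k
      = 4 * (C1 * s2 * s * k + C2 * s1 * s * k - C * s1 * s2 * k - S * s1 * s2 * s) * (1 / (4 * s1 * s2 * s * k))"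
    if "0 < s1" "0 < s2" "0 < s" "0 < k" for C1 C2 C S s1 s2 s k :: real
    using that by (simp add: field_simps)
  from this[OF pos] show ?thesis unfolding E_def[symmetric] E .
qed

text \<open>The left side is the derivative of \<open>ln (1 - exp (- 2 * (a * y))) / a\<close> in
  \<open>y\<close>, taken where \<open>a * y = x\<close>.\<close>

lemma exp_ratio_coth: "0 < x \<Longrightarrow> 2 * exp (- 2 * x) / (1 - exp (- 2 * x)) = cosh x / sinh x - (1::real)"
proof -
  assume x: "0 < x"
  have "exp (-2 * x) = exp (- x) * exp (- x)" by (simp flip: exp_add)
  moreover have "exp (-x) * exp x = 1" by (simp flip: exp_add)
  moreover have "exp (-x) < 1" using x by simp
  moreover have "exp x > 1" using x by simp
  ultimately show ?thesis unfolding cosh_field_def sinh_field_def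
    by (simp add: divide_simps mult_less_0_iff) (auto simp: algebra_simps)
qed

lemma exp_ratio_tanh: "2 * exp (- 2 * x) / (1 + exp (- 2 * x)) = 1 - sinh x / cosh (x::real)"
proof -
  have 1: "exp (-2 * x) = exp (- x) * exp (- x)" by (simp flip: exp_add)
  have 2: "exp (-x) * exp x = 1" by (simp flip: exp_add)
  have 3: "exp x + exp (-x) > 0" "1 + exp (-x) * exp (-x) > 0" by (simp_all add: add_pos_pos)
  show ?thesis unfolding cosh_field_def sinh_field_def 1
    using 2 3 by (simp add: divide_simps) (simp add: algebra_simps)
qed

lemma tendsto_one_minus_exp_over:
  fixes a :: real
  shows "((\<lambda>y. (1 - exp (- 2 * (a * y))) / y) \<longlongrightarrow> 2 * a) (at_right 0)"
proof -
  have "((\<lambda>y. 1 - exp (- 2 * (a * y))) has_real_derivative 2 * a) (at 0)"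
    by (auto intro!: derivative_eq_intros)
  then have "((\<lambda>y. (1 - exp (- 2 * (a * y))) / y) \<longlongrightarrow> 2 * a) (at 0)"
    by (simp add: DERIV_def)
  then show ?thesis by (simp add: filterlim_at_split)
qed

text \<open>With \<open>b = exp (- 2 * y)\<close> this is the logarithm of the right side over the
  left side in \<open>geometric_ratio_ineq_ordered\<close>. Its derivative has the sign pattern, and
  its limits at 0 and at infinity are 0.\<close>

lemma log_ratio_nonneg:
  fixes p q c y :: real
  assumes "1 < p" "p \<le> q" "p * q = p + q" "1 \<le> c" "c \<le> q" "0 < y"
    and cdef: "ln 2 / c = ln p / p + ln q / q"
  shows "0 \<le> ln (1 - exp (- 2 * (p * y))) / p + ln (1 - exp (- 2 * (q * y))) / q
     - ln (1 - exp (- 2 * y)) - ln (1 + exp (- 2 * (c * y))) / c"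
proof -
  have pq: "1 < q" "0 < c" "1 / p + 1 / q = 1" using assms by (auto simp: field_simps)
  define D where "D y = ln (1 - exp (- 2 * (p * y))) / p + ln (1 - exp (- 2 * (q * y))) / q
     - ln (1 - exp (- 2 * y)) - ln (1 + exp (- 2 * (c * y))) / c" for y
  define e where "e = (\<lambda>x. cosh ((p + q + 1 - c) * x) - cosh ((p + q + c - 1) * x) - 2 * cosh ((p + q - 1 - c) * x)
     + cosh ((q - p + 1 + c) * x) + cosh ((q - p - 1 - c) * x))"
  define k where "k x = sinh (p * x) * sinh (q * x) * sinh x * cosh (c * x)" for x
  have k: "0 < k x" if "0 < x" for x unfolding k_def using that assms pq by simp
  have "0 \<le> D y"
  proof (rule stays_neg_derivative_imp_nonneg[where F = D and f = "\<lambda>x. e x * (1 / (4 * k x))"])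
    show "stays_neg (\<lambda>x. e x * (1 / (4 * k x)))"
      unfolding e_def using k assms by (intro stays_neg_mult_pos[OF stays_neg_five_cosh]) auto
  next
    fix x :: real assume x: "0 < x"
    have "(D has_real_derivative 2 * exp (- 2 * (p * x)) / (1 - exp (- 2 * (p * x)))
       + 2 * exp (- 2 * (q * x)) / (1 - exp (- 2 * (q * x))) - 2 * exp (- 2 * x) / (1 - exp (- 2 * x))
       + 2 * exp (- 2 * (c * x)) / (1 + exp (- 2 * (c * x)))) (at x)"
    proof -
      have 1: "((\<lambda>x. ln (1 - exp (- 2 * (a * x))) / a) has_real_derivative
          2 * exp (- 2 * (a * x)) / (1 - exp (- 2 * (a * x)))) (at x)" if "0 < a" for a
        using that x by (auto intro!: derivative_eq_intros)
      have 2: "((\<lambda>x. ln (1 + exp (- 2 * (a * x))) / a) has_real_derivative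
          - (2 * exp (- 2 * (a * x)) / (1 + exp (- 2 * (a * x))))) (at x)" if "0 < a" for a
        using that by (auto intro!: derivative_eq_intros add_pos_pos)
      have 3: "((\<lambda>x. ln (1 - exp (- 2 * x))) has_real_derivative
          2 * exp (- 2 * x) / (1 - exp (- 2 * x))) (at x)"
        using 1[of 1] by simp
      have "0 < p" "0 < q" "0 < c" using pq \<open>1 < p\<close> by auto
      then show ?thesis
        unfolding D_def
        by (intro DERIV_cong[OF DERIV_diff[OF DERIV_diff[OF DERIV_add[OF 1 1] 3] 2]]) simp_all
    qed
    \<comment> \<open>The constants -1, -1, +1, +1 from the four quotients cancel.\<close>
    also have "2 * exp (- 2 * (p * x)) / (1 - exp (- 2 * (p * x)))
       + 2 * exp (- 2 * (q * x)) / (1 - exp (- 2 * (q * x))) - 2 * exp (- 2 * x) / (1 - exp (- 2 * x))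
       + 2 * exp (- 2 * (c * x)) / (1 + exp (- 2 * (c * x))) =
       cosh (p * x) / sinh (p * x) + cosh (q * x) / sinh (q * x) - cosh x / sinh x - sinh (c * x) / cosh (c * x)"
      using exp_ratio_coth[of "p * x"] exp_ratio_coth[of "q * x"] exp_ratio_coth[of x]
        exp_ratio_tanh[of "c * x"] x pq \<open>1 < p\<close> by simp
    also have "\<dots> = e x * (1 / (4 * k x))"
      using coth_sum_eq[of p q x c] x pq \<open>1 < p\<close> unfolding e_def k_def by (simp add: mult.assoc)
    finally show "(D has_real_derivative e x * (1 / (4 * k x))) (at x)" .
  next
    \<comment> \<open>Three of the logarithms diverge at 0. Dividing their arguments by
      \<open>y\<close> leaves the total unchanged, because the \<open>ln y\<close> terms have
      weights \<open>1 / p + 1 / q - 1 = 0\<close>.\<close>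
    define L where "L = (\<lambda>(a::real) (y::real). ln ((1 - exp (- 2 * (a * y))) / y))"
    have L: "(L a \<longlongrightarrow> ln (2 * a)) (at_right 0)" if "0 < a" for a
      unfolding L_def using that by (intro tendsto_ln tendsto_one_minus_exp_over) auto
    have "((\<lambda>y. L p y / p + L q y / q - L 1 y - ln (1 + exp (- 2 * (c * y))) / c) \<longlongrightarrow>
        ln (2 * p) / p + ln (2 * q) / q - ln (2 * 1) - ln (1 + exp (- 2 * (c * 0))) / c) (at_right 0)"
      using pq \<open>1 < p\<close> by (intro tendsto_intros L) (auto simp: add_eq_0_iff)
    also have "ln (2 * p) / p + ln (2 * q) / q - ln (2 * 1) - ln (1 + exp (- 2 * (c * 0))) / c
       = ln 2 * (1 / p + 1 / q) - ln 2 + (ln p / p + ln q / q - ln 2 / c)"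
      using pq(1) \<open>1 < p\<close> by (simp add: ln_mult add_divide_distrib algebra_simps)
    \<comment> \<open>This pins down \<open>c\<close>: by \<open>cdef\<close> the limit is exactly
      0.\<close>
    also have "\<dots> = 0" using pq cdef by simp
    finally have "((\<lambda>y. L p y / p + L q y / q - L 1 y - ln (1 + exp (- 2 * (c * y))) / c) \<longlongrightarrow> 0) (at_right 0)" .
    moreover have "\<forall>\<^sub>F y in at_right 0. L p y / p + L q y / q - L 1 y - ln (1 + exp (- 2 * (c * y))) / c = D y"
    proof (rule eventually_mono[OF eventually_at_right_less])
      fix y :: real assume y: "0 < y"
      have L_eq: "L a y = ln (1 - exp (- 2 * (a * y))) - ln y" if "0 < a" for a
        unfolding L_def using that y by (simp add: ln_div)
      have "ln y / p + ln y / q = ln y * (1 / p + 1 / q)"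
        by (simp only: distrib_left times_divide_eq_right mult_1_right)
      then have "ln y / p + ln y / q = ln y" using pq(3) by simp
      then show "L p y / p + L q y / q - L 1 y - ln (1 + exp (- 2 * (c * y))) / c = D y"
        using pq(1) \<open>1 < p\<close> unfolding D_def by (simp add: L_eq diff_divide_distrib)
    qed
    ultimately show "(D \<longlongrightarrow> 0) (at_right 0)" by (rule Lim_transform_eventually)
  next
    have E: "((\<lambda>y. exp (- 2 * (a * y))) \<longlongrightarrow> 0) at_top" if "0 < a" for a :: real
    proof (rule filterlim_compose[OF exp_at_bot])
      have "filterlim (\<lambda>y. (- 2 * a) * y) at_bot at_top"
        using that by (intro filterlim_tendsto_neg_mult_at_bot[OF tendsto_const]) (auto simp: filterlim_ident)
      then show "filterlim (\<lambda>y. - 2 * (a * y)) at_bot at_top" by (simp add: mult.assoc)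
    qed
    have "(D \<longlongrightarrow> ln (1 - 0) / p + ln (1 - 0) / q - ln (1 - 0) - ln (1 + 0) / c) at_top"
      unfolding D_def using E[of p] E[of q] E[of 1] E[of c] pq \<open>1 < p\<close>
      by (intro tendsto_intros) auto
    then show "(D \<longlongrightarrow> 0) at_top" by simp
  qed (use \<open>0 < y\<close> in auto)
  then show ?thesis unfolding D_def .
qed

lemma geometric_ratio_ineq_ordered:
  fixes p q c b :: real
  assumes "1 < p" "p \<le> q" "p * q = p + q" "1 \<le> c" "c \<le> q" "0 < b" "b < 1"
    and cdef: "ln 2 / c = ln p / p + ln q / q"
  shows "(1 - b) * (1 + b powr c) powr (1 / c) \<le> (1 - b powr p) powr (1 / p) * (1 - b powr q) powr (1 / q)"
proof -
  define y where "y = - ln b / 2"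
  have y: "0 < y" using assms unfolding y_def by simp
  have b: "b powr a = exp (- 2 * (a * y))" for a unfolding y_def powr_def using assms by simp
  have b1: "b = exp (- 2 * y)" using b[of 1] assms by simp
  have lt: "b powr p < 1" "b powr q < 1" "0 < b powr c"
    using assms y by (auto simp: b intro: mult_pos_pos)
  have ne: "1 + b powr c \<noteq> 0" using lt by linarith
  have "ln ((1 - b) * (1 + b powr c) powr (1 / c)) = ln (1 - b) + ln (1 + b powr c) / c"
    using assms lt ne by (simp add: ln_mult ln_powr)
  also have "\<dots> \<le> ln (1 - b powr p) / p + ln (1 - b powr q) / q"
    using log_ratio_nonneg[of p q c y] assms y unfolding b b1[symmetric] by simp
  also have "\<dots> = ln ((1 - b powr p) powr (1 / p) * (1 - b powr q) powr (1 / q))"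
    using assms lt by (simp add: ln_mult ln_powr)
  finally show ?thesis using assms lt by (subst (asm) ln_le_cancel_iff) (use ne in auto)
qed

text \<open>Concavity of \<open>ln\<close> with weights \<open>1 / p\<close> and
  \<open>1 / q\<close> gives \<open>ln 2 / c \<le> ln 2\<close>, hence the lower bound. The larger
  exponent is at least 2, so its term alone gives
  \<open>ln 2 / max p q \<le> ln 2 / c\<close>.\<close>

lemma exponent_bounds:
  fixes p q c :: real
  assumes "1 < p" "1 < q" "1 / p + 1 / q = 1" and c: "2 powr (1 / c) = p powr (1 / p) * q powr (1 / q)"
  shows "1 \<le> c" "c \<le> max p q" "ln 2 / c = ln p / p + ln q / q"
proof -
  have "ln 2 / c = ln (2 powr (1 / c))" by (simp add: ln_powr)
  also have "\<dots> = ln (p powr (1 / p)) + ln (q powr (1 / q))" unfolding c using assms(1,2) by (simp add: ln_mult)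
  also have "\<dots> = ln p / p + ln q / q" using assms(1,2) by (simp add: ln_powr)
  finally show eq: "ln 2 / c = ln p / p + ln q / q" .
  have pos: "0 < ln p / p" "0 < ln q / q" using assms by auto
  then have "0 < ln 2 / c" using eq by simp
  then have "0 < c" by (simp add: zero_less_divide_iff)
  have "ln p / p + ln q / q = (1 / p) *\<^sub>R ln p + (1 / q) *\<^sub>R ln q" by simp
  also have "\<dots> \<le> ln ((1 / p) *\<^sub>R p + (1 / q) *\<^sub>R q)"
  proof -
    have "1 - 1 / q = 1 / p" using assms by simp
    then show ?thesis using concave_onD[OF ln_concave, of "1 / q" p q] assms(1,2) by simp
  qed
  also have "\<dots> = ln 2" using assms by simp
  finally have "ln 2 / c \<le> ln 2" using eq by simp
  then show "1 \<le> c" using \<open>0 < c\<close> by (simp add: pos_divide_le_eq)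
  have "max p q \<ge> 2"
  proof (rule ccontr)
    assume "\<not> ?thesis"
    then have "1 / p > 1 / 2" "1 / q > 1 / 2" using assms(1,2) by (auto simp: field_simps)
    then show False using assms(3) by linarith
  qed
  have "ln 2 / max p q \<le> ln (max p q) / max p q"
    using \<open>max p q \<ge> 2\<close> by (intro divide_right_mono) auto
  also have "\<dots> \<le> ln p / p + ln q / q" using pos by (auto simp: max_def)
  finally have "ln 2 / max p q \<le> ln 2 / c" using eq by simp
  then show "c \<le> max p q"
    using \<open>0 < c\<close> divide_strict_left_mono[of "max p q" c "ln 2"] \<open>max p q \<ge> 2\<close> by fastforce
qed

lemma geometric_ratio_ineq:
  fixes p q c b :: real
  assumes "1 < p" "1 < q" "1 / p + 1 / q = 1" "2 powr (1 / c) = p powr (1 / p) * q powr (1 / q)"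
    "0 < b" "b < 1"
  shows "(1 - b) * (1 + b powr c) powr (1 / c) \<le> (1 - b powr p) powr (1 / p) * (1 - b powr q) powr (1 / q)"
proof -
  have pq: "p * q = p + q" using assms by (simp add: field_simps)
  note c = exponent_bounds[OF assms(1-4)]
  show ?thesis
  proof (cases "p \<le> q")
    case True
    then show ?thesis using assms(1,5,6) c pq by (intro geometric_ratio_ineq_ordered) simp_all
  next
    case False
    have "(1 - b) * (1 + b powr c) powr (1 / c) \<le> (1 - b powr q) powr (1 / q) * (1 - b powr p) powr (1 / p)"
    proof (rule geometric_ratio_ineq_ordered)
      show "q * p = q + p" using pq by (simp only: ac_simps)
      show "ln 2 / c = ln q / q + ln p / p" using c(3) by (simp only: ac_simps)
    qed (use False assms(1,2,5,6) c(1,2) in simp_all)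
    then show ?thesis by (simp only: mult.commute)
  qed
qed

subsection \<open>The continuous inequality\<close>

lemma emeasure_lborel_translate:
  assumes "A \<in> sets borel"
  shows "emeasure lborel ((\<lambda>x. x + b) -` A) = emeasure lborel (A :: real set)"
proof -
  have "emeasure lborel A = emeasure (distr lborel borel ((+) b)) A"
    by (simp add: lborel_distr_plus)
  also have "\<dots> = emeasure lborel ((+) b -` A \<inter> space lborel)"
    using assms by (intro emeasure_distr) auto
  finally show ?thesis by (simp add: add.commute vimage_def)
qed

text \<open>Near-extremal points \<open>a\<close> of \<open>A\<close> and \<open>b\<close> of \<open>B\<close> suffice: the translates of
  \<open>A \<inter> {..a}\<close> by \<open>b\<close> and of \<open>B \<inter> {b..}\<close> by \<open>a\<close> share at most the point \<open>a + b\<close>.\<close>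

lemma brunn_minkowski_real:
  fixes A B C :: "real set"
  assumes meas: "A \<in> sets borel" "B \<in> sets borel" "C \<in> sets borel"
    and "bounded A" "bounded B" "A \<noteq> {}" "B \<noteq> {}"
    and C: "\<And>x y. x \<in> A \<Longrightarrow> y \<in> B \<Longrightarrow> x + y \<in> C"
  shows "emeasure lborel A + emeasure lborel B \<le> emeasure lborel C"
proof (rule ennreal_le_epsilon)
  fix e :: real assume "0 < e"
  have bdd: "bdd_above A" "bdd_below B" using assms by (auto intro: bounded_imp_bdd_above bounded_imp_bdd_below)
  obtain a where a: "a \<in> A" "Sup A - e / 2 < a"
    using less_cSup_iff[of A "Sup A - e / 2"] \<open>0 < e\<close> bdd \<open>A \<noteq> {}\<close> by auto
  obtain b where b: "b \<in> B" "b < Inf B + e / 2"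
    using cInf_less_iff[of B "Inf B + e / 2"] \<open>0 < e\<close> bdd \<open>B \<noteq> {}\<close> by auto
  \<comment> \<open>The cut is strict at \<open>a\<close> only: the shifted sets lie in
    \<open>z < a + b\<close> and in \<open>z \<ge> a + b\<close>, hence are disjoint.\<close>
  define A' where "A' = (\<lambda>z. z + (- b)) -` (A \<inter> {..<a})"
  define B' where "B' = (\<lambda>z. z + (- a)) -` (B \<inter> {b..})"
  have [measurable]: "A' \<in> sets borel" "B' \<in> sets borel"
    unfolding A'_def B'_def using meas
    by (auto intro!: measurable_sets_borel[where M = borel])
  \<comment> \<open>The discarded part of \<open>A\<close> lies between \<open>a\<close> and
    \<open>Sup A\<close>, so it has length at most \<open>e / 2\<close>; \<open>B\<close> is treated
    likewise near \<open>Inf B\<close>.\<close>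
  have "A \<subseteq> (A \<inter> {..<a}) \<union> {a..a + e / 2}"
  proof
    fix x assume "x \<in> A"
    then have "x \<le> Sup A" using bdd by (intro cSup_upper)
    then show "x \<in> (A \<inter> {..<a}) \<union> {a..a + e / 2}" using a \<open>x \<in> A\<close> by auto
  qed
  then have "emeasure lborel A \<le> emeasure lborel ((A \<inter> {..<a}) \<union> {a..a + e / 2})"
    using meas by (intro emeasure_mono) auto
  also have "\<dots> \<le> emeasure lborel (A \<inter> {..<a}) + emeasure lborel {a..a + e / 2}"
    using meas by (intro emeasure_subadditive) auto
  finally have 1: "emeasure lborel A \<le> emeasure lborel A' + ennreal (e / 2)"
    unfolding A'_def using meas \<open>0 < e\<close> by (subst emeasure_lborel_translate) auto
  have "B \<subseteq> (B \<inter> {b..}) \<union> {b - e / 2..b}"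
  proof
    fix x assume "x \<in> B"
    then have "Inf B \<le> x" using bdd by (intro cInf_lower)
    then show "x \<in> (B \<inter> {b..}) \<union> {b - e / 2..b}" using b \<open>x \<in> B\<close> by auto
  qed
  then have "emeasure lborel B \<le> emeasure lborel ((B \<inter> {b..}) \<union> {b - e / 2..b})"
    using meas by (intro emeasure_mono) auto
  also have "\<dots> \<le> emeasure lborel (B \<inter> {b..}) + emeasure lborel {b - e / 2..b}"
    using meas by (intro emeasure_subadditive) auto
  finally have 2: "emeasure lborel B \<le> emeasure lborel B' + ennreal (e / 2)"
    unfolding B'_def using meas \<open>0 < e\<close> by (subst emeasure_lborel_translate) auto
  have "A' \<inter> B' = {}" unfolding A'_def B'_def by auto
  then have "emeasure lborel A' + emeasure lborel B' = emeasure lborel (A' \<union> B')"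
    by (intro plus_emeasure) auto
  also have "\<dots> \<le> emeasure lborel C"
  proof (rule emeasure_mono)
    show "A' \<union> B' \<subseteq> C"
    proof
      fix z assume "z \<in> A' \<union> B'"
      then show "z \<in> C" unfolding A'_def B'_def
        using C[of "z - b" b] C[of a "z - a"] a b by auto
    qed
  qed (use meas in auto)
  finally have 3: "emeasure lborel A' + emeasure lborel B' \<le> emeasure lborel C" .
  have "emeasure lborel A + emeasure lborel B
      \<le> (emeasure lborel A' + ennreal (e / 2)) + (emeasure lborel B' + ennreal (e / 2))"
    using 1 2 by (rule add_mono)
  also have "\<dots> = (emeasure lborel A' + emeasure lborel B') + (ennreal (e / 2) + ennreal (e / 2))"
    by (simp add: ac_simps)
  also have "ennreal (e / 2) + ennreal (e / 2) = ennreal e"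
    using \<open>0 < e\<close> by (simp flip: ennreal_plus)
  finally show "emeasure lborel A + emeasure lborel B \<le> emeasure lborel C + ennreal e"
    using 3 by (meson add_right_mono order_trans)
qed

text \<open>Tonelli's theorem for the region \<open>0 < t < f x\<close> under the graph.\<close>

lemma nn_integral_layer_cake:
  fixes f :: "'a \<Rightarrow> real"
  assumes "sigma_finite_measure M" and [measurable]: "f \<in> borel_measurable M" and "\<And>x. 0 \<le> f x"
  shows "(\<integral>\<^sup>+x. ennreal (f x) \<partial>M)
    = (\<integral>\<^sup>+t. indicator {0<..} t * emeasure M {x \<in> space M. t < f x} \<partial>lborel)"
proof -
  interpret sigma_finite_measure M by fact
  interpret pair_sigma_finite M lborel ..
  have "(\<integral>\<^sup>+x. ennreal (f x) \<partial>M) = (\<integral>\<^sup>+x. (\<integral>\<^sup>+t. indicator {(x, t). 0 < t \<and> t < f x} (x, t) \<partial>lborel) \<partial>M)"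
  proof (rule nn_integral_cong)
    fix x
    have "(\<integral>\<^sup>+t. indicator {(x, t). 0 < t \<and> t < f x} (x, t) \<partial>lborel) = (\<integral>\<^sup>+t. indicator {0<..<f x} t \<partial>lborel)"
      by (intro nn_integral_cong) (auto simp: indicator_def)
    also have "\<dots> = ennreal (f x)" using assms by simp
    finally show "ennreal (f x) = (\<integral>\<^sup>+t. indicator {(x, t). 0 < t \<and> t < f x} (x, t) \<partial>lborel)" by simp
  qed
  also have "\<dots> = (\<integral>\<^sup>+t. (\<integral>\<^sup>+x. indicator {(x, t). 0 < t \<and> t < f x} (x, t) \<partial>M) \<partial>lborel)"
    by (subst Fubini') (auto simp: case_prod_beta')
  also have "\<dots> = (\<integral>\<^sup>+t. indicator {0<..} t * emeasure M {x \<in> space M. t < f x} \<partial>lborel)"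
  proof (rule nn_integral_cong)
    fix t :: real
    have "(\<integral>\<^sup>+x. indicator {(x, t). 0 < t \<and> t < f x} (x, t) \<partial>M)
       = (\<integral>\<^sup>+x. indicator {0<..} t * indicator {x \<in> space M. t < f x} x \<partial>M)"
      by (intro nn_integral_cong) (auto simp: indicator_def)
    also have "\<dots> = indicator {0<..} t * emeasure M {x \<in> space M. t < f x}"
      by (subst nn_integral_cmult) auto
    finally show "(\<integral>\<^sup>+x. indicator {(x, t). 0 < t \<and> t < f x} (x, t) \<partial>M)
      = indicator {0<..} t * emeasure M {x \<in> space M. t < f x}" .
  qed
  finally show ?thesis .
qed

text \<open>Since \<open>t = t powr (1 / p) * t powr (1 / q)\<close>, the superlevel sets of
  \<open>G powr p\<close> and \<open>H powr q\<close> at height \<open>t\<close> add into that of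
  \<open>T\<close>. The common maximum 1 makes both nonempty for \<open>t < 1\<close>, as
  \<open>brunn_minkowski_real\<close> requires, and both empty from 1 on. Integrating over
  \<open>t\<close> concludes.\<close>

lemma prekopa_leindler_powers:
  fixes G H T :: "real \<Rightarrow> real"
  assumes pq: "1 < p" "1 < q" "1 / p + 1 / q = 1"
    and [measurable]: "G \<in> borel_measurable borel" "H \<in> borel_measurable borel" "T \<in> borel_measurable borel"
    and G: "\<And>x. 0 \<le> G x" "\<And>x. G x \<le> 1" "G a = 1" "bounded {x. G x \<noteq> 0}"
    and H: "\<And>x. 0 \<le> H x" "\<And>x. H x \<le> 1" "H b = 1" "bounded {x. H x \<noteq> 0}"
    and T: "\<And>x y. G x * H y \<le> T (x + y)" "\<And>x. 0 \<le> T x"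
  shows "(\<integral>\<^sup>+x. ennreal (G x powr p) \<partial>lborel) + (\<integral>\<^sup>+x. ennreal (H x powr q) \<partial>lborel)
    \<le> (\<integral>\<^sup>+x. ennreal (T x) \<partial>lborel)"
proof -
  have level: "emeasure lborel {x. t < G x powr p} + emeasure lborel {x. t < H x powr q}
      \<le> emeasure lborel {x. t < T x}" if "0 < t" for t
  proof (cases "t < 1")
    case True
    show ?thesis
    proof (rule brunn_minkowski_real)
      show "bounded {x. t < G x powr p}" "bounded {x. t < H x powr q}"
        using that by (auto intro: bounded_subset[OF G(4)] bounded_subset[OF H(4)])
      show "{x. t < G x powr p} \<noteq> {}" "{x. t < H x powr q} \<noteq> {}"
        using G(3) H(3) True by (auto intro: exI[of _ a] exI[of _ b])
    next
      fix x y assume "x \<in> {x. t < G x powr p}" "y \<in> {x. t < H x powr q}"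
      then have xy: "t < G x powr p" "t < H y powr q" by auto
      have "t powr (1 / p) < (G x powr p) powr (1 / p)"
        using xy that pq by (intro powr_less_mono2) auto
      then have 1: "t powr (1 / p) < G x" using pq G(1)[of x] by (simp add: powr_powr)
      have "t powr (1 / q) < (H y powr q) powr (1 / q)"
        using xy that pq by (intro powr_less_mono2) auto
      then have 2: "t powr (1 / q) < H y" using pq H(1)[of y] by (simp add: powr_powr)
      have "t = t powr (1 / p) * t powr (1 / q)"
        using that pq by (simp flip: powr_add)
      also have "\<dots> < G x * H y" using 1 2 by (intro mult_strict_mono') auto
      also have "\<dots> \<le> T (x + y)" by (rule T)
      finally show "x + y \<in> {x. t < T x}" by simp
    qed measurable
  next
    case False
    have "G x powr p \<le> 1" "H x powr q \<le> 1" for x using G H pq by (auto intro!: powr_le1)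
    then have "{x. t < G x powr p} = {}" "{x. t < H x powr q} = {}"
      using False by (auto simp: not_less intro: order_trans)
    then show ?thesis by simp
  qed
  have *: "(\<integral>\<^sup>+x. ennreal (f x) \<partial>lborel) = (\<integral>\<^sup>+t. indicator {0<..} t * emeasure lborel {x. t < f x} \<partial>lborel)"
    if "f \<in> borel_measurable borel" "\<And>x. 0 \<le> f x" for f :: "real \<Rightarrow> real"
    using nn_integral_layer_cake[of lborel f] that by (simp add: lborel.sigma_finite_measure_axioms)
  have m: "(\<lambda>t. indicator {0<..} t * emeasure lborel {x. t < f x}) \<in> borel_measurable lborel"
    if [measurable]: "f \<in> borel_measurable borel" for f :: "real \<Rightarrow> real"
    by measurable
  show ?thesis
    using G(1) H(1) T(2)
    by (simp add: * m flip: nn_integral_add)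
      (auto intro!: nn_integral_mono level simp: indicator_def)
qed

subsection \<open>Dimension one\<close>

lemma nn_integral_exp_cell:
  fixes k :: real and i :: int
  assumes "0 < k"
  shows "(\<integral>\<^sup>+x. ennreal (exp (- (k * (x - i)))) * indicator {real_of_int i..<real_of_int i + 1} x \<partial>lborel)
    = ennreal ((1 - exp (- k)) / k)"
proof -
  have "(\<integral>\<^sup>+x. ennreal (exp (- (k * (x - i)))) * indicator {real_of_int i..<real_of_int i + 1} x \<partial>lborel)
     = (\<integral>\<^sup>+x. ennreal (exp (- (k * (x - i)))) * indicator {real_of_int i..real_of_int i + 1} x \<partial>lborel)"
    by (intro nn_integral_cong_AE eventually_mono[OF AE_lborel_singleton[of "real_of_int i + 1"]])
      (auto simp: indicator_def)
  also have "\<dots> = ennreal (- exp (- (k * (real_of_int i + 1 - i))) / k - (- exp (- (k * (real_of_int i - i))) / k))"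
    using assms
    by (intro nn_integral_FTC_Icc[where F = "\<lambda>x. - exp (- (k * (x - real_of_int i))) / k"])
      (auto intro!: derivative_eq_intros)
  also have "- exp (- (k * (real_of_int i + 1 - i))) / k - (- exp (- (k * (real_of_int i - i))) / k) = (1 - exp (- k)) / k"
    by (simp add: diff_divide_distrib)
  finally show ?thesis .
qed

text \<open>The power \<open>r\<close> of a profile with rate \<open>k\<close> is a profile with
  rate \<open>r * k\<close>, so this evaluates all three integrals that occur, with rates
  \<open>p * k\<close>, \<open>q * k\<close> and \<open>k\<close>.\<close>

lemma nn_integral_exp_frac:
  fixes k :: real and \<phi> :: "int \<Rightarrow> real"
  assumes "0 < k" "finite S" "\<And>i. i \<in> S \<Longrightarrow> 0 \<le> \<phi> i"
  shows "(\<integral>\<^sup>+x. ennreal (if \<lfloor>x\<rfloor> \<in> S then \<phi> \<lfloor>x\<rfloor> * exp (- (k * frac x)) else 0) \<partial>lborel)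
    = ennreal (sum \<phi> S * ((1 - exp (- k)) / k))"
proof -
  have cell: "indicator {real_of_int i..<real_of_int i + 1} x = (if i = \<lfloor>x\<rfloor> then 1 else 0 :: ennreal)" for i x
    by (auto simp: indicator_def) linarith+
  have "(\<integral>\<^sup>+x. ennreal (if \<lfloor>x\<rfloor> \<in> S then \<phi> \<lfloor>x\<rfloor> * exp (- (k * frac x)) else 0) \<partial>lborel)
    = (\<integral>\<^sup>+x. (\<Sum>i\<in>S. ennreal (\<phi> i) * (ennreal (exp (- (k * (x - i)))) * indicator {real_of_int i..<real_of_int i + 1} x)) \<partial>lborel)"
  proof (rule nn_integral_cong)
    fix x :: real
    have "(\<Sum>i\<in>S. ennreal (\<phi> i) * (ennreal (exp (- (k * (x - i)))) * indicator {real_of_int i..<real_of_int i + 1} x))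
      = (\<Sum>i\<in>S. if i = \<lfloor>x\<rfloor> then ennreal (\<phi> i) * ennreal (exp (- (k * (x - i)))) else 0)"
      unfolding cell by (intro sum.cong) auto
    also have "\<dots> = ennreal (if \<lfloor>x\<rfloor> \<in> S then \<phi> \<lfloor>x\<rfloor> * exp (- (k * frac x)) else 0)"
      using assms by (simp add: sum.delta frac_def ennreal_mult)
    finally show "ennreal (if \<lfloor>x\<rfloor> \<in> S then \<phi> \<lfloor>x\<rfloor> * exp (- (k * frac x)) else 0)
      = (\<Sum>i\<in>S. ennreal (\<phi> i) * (ennreal (exp (- (k * (x - i)))) * indicator {real_of_int i..<real_of_int i + 1} x))" by simp
  qed
  also have "\<dots> = (\<Sum>i\<in>S. ennreal (\<phi> i) * ennreal ((1 - exp (- k)) / k))"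
    using nn_integral_exp_cell[OF \<open>0 < k\<close>] by (simp add: nn_integral_sum nn_integral_cmult)
  also have "\<dots> = ennreal (sum \<phi> S * ((1 - exp (- k)) / k))"
  proof -
    have "0 \<le> (1 - exp (- k)) / k" using assms by simp
    then have "(\<Sum>i\<in>S. ennreal (\<phi> i) * ennreal ((1 - exp (- k)) / k)) = (\<Sum>i\<in>S. ennreal (\<phi> i * ((1 - exp (- k)) / k)))"
      using assms by (intro sum.cong refl ennreal_mult[symmetric]) auto
    also have "\<dots> = ennreal (\<Sum>i\<in>S. \<phi> i * ((1 - exp (- k)) / k))"
      using assms \<open>0 \<le> (1 - exp (- k)) / k\<close> by (intro sum_ennreal) auto
    finally show ?thesis by (simp only: sum_distrib_right)
  qed
  finally show ?thesis .
qed

lemma borel_measurable_exp_frac: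
  fixes \<phi> :: "int \<Rightarrow> real"
  shows "(\<lambda>x. if \<lfloor>x\<rfloor> \<in> S then \<phi> \<lfloor>x\<rfloor> * exp (- (k * frac x)) else 0) \<in> borel_measurable borel"
  unfolding frac_def by measurable

lemma bounded_floor_support:
  fixes f :: "real \<Rightarrow> real"
  assumes "finite S" "\<And>x. f x \<noteq> 0 \<Longrightarrow> \<lfloor>x\<rfloor> \<in> S"
  shows "bounded {x. f x \<noteq> 0}"
proof -
  have "bounded (\<Union>i\<in>S. {real_of_int i..real_of_int i + 1})" using assms(1) by (intro bounded_UN) auto
  moreover have "{x. f x \<noteq> 0} \<subseteq> (\<Union>i\<in>S. {real_of_int i..real_of_int i + 1})"
  proof
    fix x assume "x \<in> {x. f x \<noteq> 0}"
    then have "\<lfloor>x\<rfloor> \<in> S" using assms(2) by simp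
    then show "x \<in> (\<Union>i\<in>S. {real_of_int i..real_of_int i + 1})"
      by (rule UN_I) (simp add: less_imp_le)
  qed
  ultimately show ?thesis by (rule bounded_subset)
qed

text \<open>Extend \<open>g\<close> and \<open>h\<close> to the reals by the exponential profile \<open>b ^ frac x\<close> on each unit cell.
  Adding two arguments whose fractional parts carry over costs exactly the factor \<open>b\<close>, which is
  the weight of the point \<open>1\<close>.\<close>

lemma two_point_ineq_normalized:
  fixes g h T :: "int \<Rightarrow> real"
  assumes pq: "1 < p" "1 < q" "1 / p + 1 / q = 1" and c: "2 powr (1 / c) = p powr (1 / p) * q powr (1 / q)"
    and b: "0 < b" "b < 1" and fin: "finite S" "finite R"
    and g: "\<And>x. x \<in> S \<Longrightarrow> 0 \<le> g x" "\<And>x. x \<in> S \<Longrightarrow> g x \<le> 1" "i \<in> S" "g i = 1"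
    and h: "\<And>x. x \<in> S \<Longrightarrow> 0 \<le> h x" "\<And>x. x \<in> S \<Longrightarrow> h x \<le> 1" "j \<in> S" "h j = 1"
    and T0: "\<And>z. z \<in> R \<Longrightarrow> 0 \<le> T z"
    and R: "\<And>x y. x \<in> S \<Longrightarrow> y \<in> S \<Longrightarrow> x + y \<in> R \<and> x + y + 1 \<in> R"
    and T: "\<And>x y. x \<in> S \<Longrightarrow> y \<in> S \<Longrightarrow> g x * h y \<le> T (x + y)"
      "\<And>x y. x \<in> S \<Longrightarrow> y \<in> S \<Longrightarrow> b * (g x * h y) \<le> T (x + y + 1)"
  shows "(1 + b powr c) powr (1 / c) * ((\<Sum>x\<in>S. g x powr p) powr (1 / p) * (\<Sum>x\<in>S. h x powr q) powr (1 / q))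
    \<le> sum T R"
proof -
  \<comment> \<open>With this rate, \<open>exp (- (k * frac x))\<close> is
    \<open>b powr frac x\<close>.\<close>
  define k where "k = - ln b"
  have k: "0 < k" unfolding k_def using b by simp
  have bexp: "b powr r = exp (- (r * k))" for r unfolding k_def powr_def using b by simp
  have b1: "b = exp (- k)" unfolding k_def using b by simp
  define G where "G x = (if \<lfloor>x\<rfloor> \<in> S then g \<lfloor>x\<rfloor> * exp (- (k * frac x)) else 0)" for x :: real
  define H where "H x = (if \<lfloor>x\<rfloor> \<in> S then h \<lfloor>x\<rfloor> * exp (- (k * frac x)) else 0)" for x :: real
  define U where "U x = (if \<lfloor>x\<rfloor> \<in> R then T \<lfloor>x\<rfloor> * exp (- (k * frac x)) else 0)" for x :: real
  have dom: "G x * H y \<le> U (x + y)" for x y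
  proof (cases "\<lfloor>x\<rfloor> \<in> S \<and> \<lfloor>y\<rfloor> \<in> S")
    case False
    then show ?thesis unfolding G_def H_def U_def using T0 by auto
  next
    case True
    then have GH: "G x * H y = g \<lfloor>x\<rfloor> * h \<lfloor>y\<rfloor> * exp (- (k * (frac x + frac y)))"
      unfolding G_def H_def by (simp add: distrib_left flip: exp_add)
    show ?thesis
    proof (cases "frac x + frac y < 1")
      case 1: True
      then have "\<lfloor>x + y\<rfloor> = \<lfloor>x\<rfloor> + \<lfloor>y\<rfloor>" "frac (x + y) = frac x + frac y"
        by (simp_all add: floor_add frac_add)
      then show ?thesis unfolding GH U_def using True R T(1)[of "\<lfloor>x\<rfloor>" "\<lfloor>y\<rfloor>"] by simp
    next
      case 2: False
      then have fl: "\<lfloor>x + y\<rfloor> = \<lfloor>x\<rfloor> + \<lfloor>y\<rfloor> + 1" "frac (x + y) = frac x + frac y - 1"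
        by (simp_all add: floor_add frac_add)
      have "G x * H y = b * (g \<lfloor>x\<rfloor> * h \<lfloor>y\<rfloor>) * exp (- (k * frac (x + y)))"
        unfolding GH fl b1 by (simp add: algebra_simps flip: exp_add)
      also have "\<dots> \<le> T (\<lfloor>x\<rfloor> + \<lfloor>y\<rfloor> + 1) * exp (- (k * frac (x + y)))"
        using True T(2) by (intro mult_right_mono) auto
      finally show ?thesis unfolding U_def using True R fl by simp
    qed
  qed
  have G01: "0 \<le> G x" "G x \<le> 1" for x
    unfolding G_def using g(1,2) k by (auto intro!: mult_le_one)
  have H01: "0 \<le> H x" "H x \<le> 1" for x
    unfolding H_def using h(1,2) k by (auto intro!: mult_le_one)
  have U0: "0 \<le> U x" for x unfolding U_def using T0 by auto
  have "(\<integral>\<^sup>+x. ennreal (G x powr p) \<partial>lborel) + (\<integral>\<^sup>+x. ennreal (H x powr q) \<partial>lborel)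
    \<le> (\<integral>\<^sup>+x. ennreal (U x) \<partial>lborel)"
  proof (rule prekopa_leindler_powers[OF pq])
    show "bounded {x. G x \<noteq> 0}" "bounded {x. H x \<noteq> 0}"
      by (rule bounded_floor_support[OF fin(1)]; simp add: G_def H_def split: if_splits)+
    show "G (real_of_int i) = 1" "H (real_of_int j) = 1" using g h by (simp_all add: G_def H_def)
    show "G \<in> borel_measurable borel" "H \<in> borel_measurable borel" "U \<in> borel_measurable borel"
      unfolding G_def H_def U_def by (intro borel_measurable_exp_frac)+
  qed (fact G01 H01 U0 dom)+
  also have "(\<lambda>x. G x powr p) = (\<lambda>x. if \<lfloor>x\<rfloor> \<in> S then g \<lfloor>x\<rfloor> powr p * exp (- ((p * k) * frac x)) else 0)"
    unfolding G_def using g(1) by (auto simp: powr_mult powr_def[of "exp _"] algebra_simps)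
  also have "(\<lambda>x. H x powr q) = (\<lambda>x. if \<lfloor>x\<rfloor> \<in> S then h \<lfloor>x\<rfloor> powr q * exp (- ((q * k) * frac x)) else 0)"
    unfolding H_def using h(1) by (auto simp: powr_mult powr_def[of "exp _"] algebra_simps)
  finally have int: "ennreal ((\<Sum>x\<in>S. g x powr p) * ((1 - exp (- (p * k))) / (p * k)))
      + ennreal ((\<Sum>x\<in>S. h x powr q) * ((1 - exp (- (q * k))) / (q * k)))
      \<le> ennreal (sum T R * ((1 - exp (- k)) / k))"
    using nn_integral_exp_frac[of "p * k" S "\<lambda>i. g i powr p"] nn_integral_exp_frac[of "q * k" S "\<lambda>i. h i powr q"]
      nn_integral_exp_frac[of k R T] k pq fin T0 unfolding U_def by simp
  define X where "X = (\<Sum>x\<in>S. g x powr p)"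
  define Y where "Y = (\<Sum>x\<in>S. h x powr q)"
  have XY: "0 \<le> X" "0 \<le> Y" unfolding X_def Y_def by (simp_all add: sum_nonneg)
  define K where "K r = 1 - exp (- (r * k))" for r
  have K: "0 < K r" if "0 < r" for r unfolding K_def using that k by simp
  have "X * (K p / (p * k)) + Y * (K q / (q * k)) \<le> sum T R * (K 1 / k)"
  proof -
    have nn: "0 \<le> X * (K p / (p * k))" "0 \<le> Y * (K q / (q * k))" "0 \<le> sum T R * (K 1 / k)"
      using XY K[of p] K[of q] K[of 1] k pq sum_nonneg[of R T] T0 by auto
    show ?thesis using int nn unfolding X_def[symmetric] Y_def[symmetric] K_def
      by (simp add: ennreal_plus[symmetric] del: ennreal_plus)
  qed
  \<comment> \<open>Young's inequality; its weights \<open>1 / p\<close> and \<open>1 / q\<close>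
    are the factors that the rates \<open>p * k\<close> and \<open>q * k\<close> leave in the
    integrals.\<close>
  moreover have "(X * K p / k) powr (1 / p) * (Y * K q / k) powr (1 / q)
      \<le> X * (K p / (p * k)) + Y * (K q / (q * k))"
  proof -
    have "0 \<le> X * K p / k" "0 \<le> Y * K q / k" using XY K[of p] K[of q] k pq by auto
    then have "((X * K p / k) powr (1 / p)) powr p / p = X * (K p / (p * k))"
        "((Y * K q / k) powr (1 / q)) powr q / q = Y * (K q / (q * k))"
      using pq(1,2) XY K[of p] K[of q] k by (simp_all add: powr_powr abs_mult)
    then show ?thesis
      using Youngs_inequality[OF pq, of "(X * K p / k) powr (1 / p)" "(Y * K q / k) powr (1 / q)"] by simp
  qed
  moreover have "(X * K p / k) powr (1 / p) * (Y * K q / k) powr (1 / q)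
     = X powr (1 / p) * Y powr (1 / q) * (K p powr (1 / p) * K q powr (1 / q)) / k"
  proof -
    have "(X * K p / k) powr (1 / p) * (Y * K q / k) powr (1 / q)
       = X powr (1 / p) * Y powr (1 / q) * (K p powr (1 / p) * K q powr (1 / q)) / (k powr (1 / p) * k powr (1 / q))"
      using XY K[of p] K[of q] k pq(1,2) by (simp add: powr_mult powr_divide)
    also have "k powr (1 / p) * k powr (1 / q) = k" using pq(3) k by (simp flip: powr_add)
    finally show ?thesis .
  qed
  ultimately have "X powr (1 / p) * Y powr (1 / q) * (K p powr (1 / p) * K q powr (1 / q)) / k \<le> sum T R * K 1 / k"
    by simp
  then have "X powr (1 / p) * Y powr (1 / q) * (K p powr (1 / p) * K q powr (1 / q)) \<le> sum T R * K 1"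
    using k divide_le_cancel by blast
  note upper = this
  \<comment> \<open>\<open>K r\<close> is \<open>1 - b powr r\<close>, so the scalar inequality
    produces \<open>K 1\<close> times the norm of the two-point function; \<open>K 1\<close> then
    cancels.\<close>
  have "K 1 * (1 + b powr c) powr (1 / c) \<le> K p powr (1 / p) * K q powr (1 / q)"
    using geometric_ratio_ineq[OF pq c b] unfolding K_def bexp[symmetric] using b by simp
  then have "X powr (1 / p) * Y powr (1 / q) * (K 1 * (1 + b powr c) powr (1 / c))
     \<le> X powr (1 / p) * Y powr (1 / q) * (K p powr (1 / p) * K q powr (1 / q))"
    by (intro mult_left_mono) auto
  also note upper
  finally have "K 1 * ((1 + b powr c) powr (1 / c) * (X powr (1 / p) * Y powr (1 / q))) \<le> K 1 * sum T R"
    by (simp only: ac_simps)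
  then show ?thesis using K[of 1] unfolding X_def Y_def by simp
qed

section \<open>Arbitrary weights in dimension one\<close>

text \<open>Homogeneity: dividing the weights by \<open>a\<close>, \<open>g\<close> and
  \<open>h\<close> by their maxima \<open>M\<close> and \<open>N\<close>, and \<open>T\<close> by
  \<open>a * M * N\<close> reduces to \<open>two_point_ineq_normalized\<close> with ratio
  \<open>b / a\<close>.\<close>

lemma two_point_ineq_ordered:
  fixes g h T :: "int \<Rightarrow> real"
  assumes pq: "1 < p" "1 < q" "1 / p + 1 / q = 1" and c: "2 powr (1 / c) = p powr (1 / p) * q powr (1 / q)"
    and ab: "0 < b" "b < a" and fin: "finite S" "finite R"
    and g: "\<And>x. 0 \<le> g x" and h: "\<And>x. 0 \<le> h x" and T0: "\<And>z. 0 \<le> T z"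
    and R: "\<And>x y. x \<in> S \<Longrightarrow> y \<in> S \<Longrightarrow> x + y \<in> R \<and> x + y + 1 \<in> R"
    and T: "\<And>x y. x \<in> S \<Longrightarrow> y \<in> S \<Longrightarrow> a * g x * h y \<le> T (x + y)"
      "\<And>x y. x \<in> S \<Longrightarrow> y \<in> S \<Longrightarrow> b * g x * h y \<le> T (x + y + 1)"
  shows "(a powr c + b powr c) powr (1 / c) * (\<Sum>x\<in>S. g x powr p) powr (1 / p) * (\<Sum>x\<in>S. h x powr q) powr (1 / q)
    \<le> sum T R"
proof (cases "(\<forall>x\<in>S. g x = 0) \<or> (\<forall>x\<in>S. h x = 0)")
  case True
  then have "(\<Sum>x\<in>S. g x powr p) = 0 \<or> (\<Sum>x\<in>S. h x powr q) = 0" by auto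
  then show ?thesis using T0 by (auto simp: sum_nonneg)
next
  case False
  then have S: "S \<noteq> {}" by auto
  define M where "M = Max (g ` S)"
  define N where "N = Max (h ` S)"
  have M: "g x \<le> M" "h x \<le> N" if "x \<in> S" for x unfolding M_def N_def using that fin by auto
  have "M \<in> g ` S" "N \<in> h ` S" unfolding M_def N_def using fin S by simp_all
  then obtain i j where i: "i \<in> S" "g i = M" and j: "j \<in> S" "h j = N" by auto
  from False obtain x y where xy: "x \<in> S" "g x \<noteq> 0" "y \<in> S" "h y \<noteq> 0" by auto
  have pos: "0 < M" "0 < N" "0 < a"
    using M(1)[OF xy(1)] M(2)[OF xy(3)] g[of x] h[of y] xy(2,4) ab by linarith+
  have "(1 + (b / a) powr c) powr (1 / c) * ((\<Sum>x\<in>S. (g x / M) powr p) powr (1 / p) * (\<Sum>x\<in>S. (h x / N) powr q) powr (1 / q))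
    \<le> (\<Sum>z\<in>R. T z / (a * M * N))"
  proof (rule two_point_ineq_normalized[where i = i and j = j, OF pq c _ _ fin])
    fix x y assume xy: "x \<in> S" "y \<in> S"
    show "g x / M * (h y / N) \<le> T (x + y) / (a * M * N)"
      using divide_right_mono[OF T(1)[OF xy], of "a * M * N"] pos by simp
    show "b / a * (g x / M * (h y / N)) \<le> T (x + y + 1) / (a * M * N)"
      using divide_right_mono[OF T(2)[OF xy], of "a * M * N"] pos by (simp add: mult.assoc)
  qed (use ab pos i j M g h T0 R in auto)
  also have "(\<Sum>x\<in>S. (g x / M) powr p) powr (1 / p) = (\<Sum>x\<in>S. g x powr p) powr (1 / p) / M"
    using g pos(1) pq(1) by (simp add: powr_divide sum_nonneg powr_powr flip: sum_divide_distrib)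
  also have "(\<Sum>x\<in>S. (h x / N) powr q) powr (1 / q) = (\<Sum>x\<in>S. h x powr q) powr (1 / q) / N"
    using h pos(2) pq(2) by (simp add: powr_divide sum_nonneg powr_powr flip: sum_divide_distrib)
  also have "(1 + (b / a) powr c) powr (1 / c) = (a powr c + b powr c) powr (1 / c) / a"
  proof -
    have "1 \<le> c" using exponent_bounds[OF pq c] by simp
    have "1 + (b / a) powr c = (a powr c + b powr c) / a powr c"
      using ab by (simp add: powr_divide add_divide_distrib)
    then show ?thesis using ab \<open>1 \<le> c\<close> by (simp add: powr_divide powr_powr)
  qed
  also have "(\<Sum>z\<in>R. T z / (a * M * N)) = sum T R / (a * M * N)"
    by (simp add: sum_divide_distrib)
  finally have "(a powr c + b powr c) powr (1 / c) * (\<Sum>x\<in>S. g x powr p) powr (1 / p)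
      * (\<Sum>x\<in>S. h x powr q) powr (1 / q) / (a * M * N) \<le> sum T R / (a * M * N)"
    by (simp add: mult.assoc)
  moreover have "0 < a * M * N" using pos by simp
  ultimately show ?thesis using divide_le_cancel by (metis order_less_asym)
qed

text \<open>If \<open>f 1\<close> is the larger weight, replacing \<open>v\<close> by
  \<open>1 - v\<close> swaps the two points; replacing \<open>x\<close>, \<open>y\<close> by their
  negatives and \<open>z\<close> by \<open>1 - z\<close> then preserves
  \<open>z = v + x + y\<close>.\<close>

lemma two_point_ineq_distinct:
  fixes f g h T :: "int \<Rightarrow> real"
  assumes pq: "1 < p" "1 < q" "1 / p + 1 / q = 1" and c: "2 powr (1 / c) = p powr (1 / p) * q powr (1 / q)"
    and f: "0 < f 0" "0 < f 1" "f 0 \<noteq> f 1" and fin: "finite S" "finite R"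
    and g: "\<And>x. 0 \<le> g x" and h: "\<And>x. 0 \<le> h x" and T0: "\<And>z. 0 \<le> T z"
    and R: "\<And>v x y. v \<in> {0, 1} \<Longrightarrow> x \<in> S \<Longrightarrow> y \<in> S \<Longrightarrow> v + x + y \<in> R"
    and T: "\<And>v x y. v \<in> {0, 1} \<Longrightarrow> x \<in> S \<Longrightarrow> y \<in> S \<Longrightarrow> f v * g x * h y \<le> T (v + x + y)"
  shows "(f 0 powr c + f 1 powr c) powr (1 / c) * (\<Sum>x\<in>S. g x powr p) powr (1 / p) * (\<Sum>x\<in>S. h x powr q) powr (1 / q)
    \<le> sum T R"
proof (cases "f 1 < f 0")
  case True
  have "x + y \<in> R \<and> x + y + 1 \<in> R" "f 0 * g x * h y \<le> T (x + y)" "f 1 * g x * h y \<le> T (x + y + 1)"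
    if "x \<in> S" "y \<in> S" for x y
    using R[of 0 x y] R[of 1 x y] T[of 0 x y] T[of 1 x y] that by (simp_all add: algebra_simps)
  then show ?thesis
    using True f by (intro two_point_ineq_ordered[OF pq c _ _ fin g h T0])
next
  case False
  have inj: "inj_on uminus S" "inj_on ((-) 1) R" by (auto simp: inj_on_def)
  have sums: "(\<Sum>x\<in>uminus ` S. g (- x) powr p) = (\<Sum>x\<in>S. g x powr p)"
    "(\<Sum>x\<in>uminus ` S. h (- x) powr q) = (\<Sum>x\<in>S. h x powr q)"
    "(\<Sum>z\<in>(-) 1 ` R. T (1 - z)) = sum T R"
    using inj by (simp_all add: sum.reindex o_def)
  have "(f 1 powr c + f 0 powr c) powr (1 / c) * (\<Sum>x\<in>uminus ` S. g (- x) powr p) powr (1 / p)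
      * (\<Sum>x\<in>uminus ` S. h (- x) powr q) powr (1 / q) \<le> (\<Sum>z\<in>(-) 1 ` R. T (1 - z))"
  proof (rule two_point_ineq_ordered[OF pq c])
    fix x y assume "x \<in> uminus ` S" "y \<in> uminus ` S"
    then have xy: "- x \<in> S" "- y \<in> S" by auto
    show "f 1 * g (- x) * h (- y) \<le> T (1 - (x + y))"
      using T[OF _ xy, of 1] by (simp add: algebra_simps)
    show "f 0 * g (- x) * h (- y) \<le> T (1 - (x + y + 1))"
      using T[OF _ xy, of 0] by (simp add: algebra_simps)
    have "x + y = 1 - (1 + - x + - y)" "x + y + 1 = 1 - (0 + - x + - y)" by simp_all
    then show "x + y \<in> (-) 1 ` R \<and> x + y + 1 \<in> (-) 1 ` R"
      using R[OF _ xy, of 1] R[OF _ xy, of 0] by (metis imageI insertCI)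
  qed (use False f fin g h T0 in auto)
  then show ?thesis unfolding sums by (simp add: add.commute)
qed

text \<open>Equal or vanishing weights are reached by approximation: both weights are raised
  slightly to become positive and distinct, and \<open>T\<close> is raised by a constant to keep the
  domination.\<close>

lemma two_point_ineq:
  fixes f g h T :: "int \<Rightarrow> real"
  assumes pq: "1 < p" "1 < q" "1 / p + 1 / q = 1" and c: "2 powr (1 / c) = p powr (1 / p) * q powr (1 / q)"
    and f: "\<And>v. 0 \<le> f v" and fin: "finite S" "finite R"
    and g: "\<And>x. 0 \<le> g x" and h: "\<And>x. 0 \<le> h x" and T0: "\<And>z. 0 \<le> T z"
    and R: "\<And>v x y. v \<in> {0, 1} \<Longrightarrow> x \<in> S \<Longrightarrow> y \<in> S \<Longrightarrow> v + x + y \<in> R"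
    and T: "\<And>v x y. v \<in> {0, 1} \<Longrightarrow> x \<in> S \<Longrightarrow> y \<in> S \<Longrightarrow> f v * g x * h y \<le> T (v + x + y)"
  shows "(\<Sum>v\<in>{0, 1}. f v powr c) powr (1 / c) * (\<Sum>x\<in>S. g x powr p) powr (1 / p) * (\<Sum>x\<in>S. h x powr q) powr (1 / q)
    \<le> sum T R"
proof (rule field_le_epsilon)
  fix e :: real assume "0 < e"
  define B where "B = (\<Sum>x\<in>S. \<Sum>y\<in>S. g x * h y)"
  have B0: "0 \<le> B" unfolding B_def using g h by (intro sum_nonneg) auto
  have B: "g x * h y \<le> B" if "x \<in> S" "y \<in> S" for x y
  proof -
    have "g x * h y \<le> (\<Sum>y\<in>S. g x * h y)" using that fin g h by (intro member_le_sum) auto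
    also have "\<dots> \<le> B" unfolding B_def using that fin g h
      by (intro member_le_sum[of x S "\<lambda>x. \<Sum>y\<in>S. g x * h y"]) (auto intro!: sum_nonneg)
    finally show ?thesis .
  qed
  \<comment> \<open>Raising \<open>T\<close> by \<open>d * B\<close> on all of \<open>R\<close> must
    cost at most \<open>e\<close>; the \<open>+ 1\<close> keeps the denominator positive.\<close>
  define d where "d = e / (B * card R + 1)"
  have d: "0 < d" "d * B * card R \<le> e"
    unfolding d_def using \<open>0 < e\<close> B0 by (simp_all add: divide_simps mult_nonneg_nonneg add_nonneg_pos)
  \<comment> \<open>At most one of the candidates \<open>d / 2\<close> and \<open>d / 3\<close>
    makes the raised weights equal.\<close>
  define d' where "d' = (if f 0 + d = f 1 + d / 2 then d / 3 else d / 2)"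
  have d': "0 < d'" "d' \<le> d" "f 0 + d \<noteq> f 1 + d'" unfolding d'_def using d(1) by auto
  define f' where "f' v = (if v = 0 then f 0 + d else f 1 + d')" for v :: int
  have 1: "1 \<le> c" using exponent_bounds[OF pq c] by simp
  have "(\<Sum>v\<in>{0, 1}. f v powr c) powr (1 / c) \<le> (f' 0 powr c + f' 1 powr c) powr (1 / c)"
    unfolding f'_def using f 1 d d' by (auto intro!: powr_mono2 add_mono)
  then have "(\<Sum>v\<in>{0, 1}. f v powr c) powr (1 / c) * (\<Sum>x\<in>S. g x powr p) powr (1 / p) * (\<Sum>x\<in>S. h x powr q) powr (1 / q)
    \<le> (f' 0 powr c + f' 1 powr c) powr (1 / c) * (\<Sum>x\<in>S. g x powr p) powr (1 / p) * (\<Sum>x\<in>S. h x powr q) powr (1 / q)"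
    by (intro mult_right_mono) auto
  also have "\<dots> \<le> (\<Sum>z\<in>R. T z + d * B)"
  proof (rule two_point_ineq_distinct[where f = f', OF pq c _ _ _ fin g h])
    show "0 < f' 0" "0 < f' 1" "f' 0 \<noteq> f' 1" unfolding f'_def
      using f[of 0] f[of 1] d d' by (auto intro: add_nonneg_pos)
    show "0 \<le> T z + d * B" for z using T0[of z] d B0 by simp
    fix v x y assume vxy: "v \<in> {0, 1 :: int}" "x \<in> S" "y \<in> S"
    show "v + x + y \<in> R" using R vxy .
    have "f' v \<le> f v + d" using vxy d' unfolding f'_def by auto
    then have "f' v * (g x * h y) \<le> (f v + d) * (g x * h y)" using g h by (intro mult_right_mono) auto
    also have "\<dots> = f v * g x * h y + d * (g x * h y)" by (simp add: algebra_simps)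
    also have "\<dots> \<le> T (v + x + y) + d * B"
      using T[OF vxy] B[OF vxy(2,3)] d by (intro add_mono mult_left_mono) auto
    finally show "f' v * g x * h y \<le> T (v + x + y) + d * B" by (simp add: mult.assoc)
  qed
  also have "\<dots> \<le> sum T R + e" using d by (simp add: sum.distrib mult.commute mult.left_commute)
  finally show "(\<Sum>v\<in>{0, 1}. f v powr c) powr (1 / c) * (\<Sum>x\<in>S. g x powr p) powr (1 / p) * (\<Sum>x\<in>S. h x powr q) powr (1 / q)
    \<le> sum T R + e" .
qed

subsection \<open>Tensorization\<close>

text \<open>Coordinates outside \<open>I\<close> are frozen at \<open>0\<close>, so that induction on \<open>I\<close> replaces
  induction on the dimension.\<close>

definition grid :: "'d set \<Rightarrow> int set \<Rightarrow> (int ^ 'd) set" where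
  "grid I S = {x. \<forall>i. if i \<in> I then x $ i \<in> S else x $ i = 0}"

lemma grid_empty: "grid {} S = {0}"
  unfolding grid_def by (auto simp: vec_eq_iff)

lemma mem_grid_insert:
  assumes "j \<notin> I" "s \<in> S" "x \<in> grid I S"
  shows "x + axis j s \<in> grid (insert j I) S"
  unfolding grid_def
proof (intro CollectI allI)
  fix i
  show "if i \<in> insert j I then (x + axis j s) $ i \<in> S else (x + axis j s) $ i = 0"
    using assms by (cases "i = j") (auto simp: grid_def axis_def dest: spec[of _ i] spec[of _ j])
qed

text \<open>The cut into slices: \<open>s\<close> is coordinate \<open>j\<close>, and
  \<open>x\<close> is the point with that coordinate reset to 0.\<close>

lemma bij_betw_grid_insert:
  assumes "j \<notin> I"
  shows "bij_betw (\<lambda>(s, x). x + axis j s) (S \<times> grid I S) (grid (insert j I) S)"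
proof (rule bij_betw_byWitness[where f' = "\<lambda>x. (x $ j, x - axis j (x $ j))"])
  have "x $ j = 0" if "x \<in> grid I S" for x
    using that assms unfolding grid_def by (auto dest: spec[of _ j])
  then show "\<forall>a\<in>S \<times> grid I S. (\<lambda>x. (x $ j, x - axis j (x $ j))) (case a of (s, x) \<Rightarrow> x + axis j s) = a"
    by (auto simp: axis_def)
  show "(\<lambda>(s, x). x + axis j s) ` (S \<times> grid I S) \<subseteq> grid (insert j I) S"
    using assms by (auto intro: mem_grid_insert)
  have "x - axis j (x $ j) \<in> grid I S" if "x \<in> grid (insert j I) S" for x
    unfolding grid_def
  proof (intro CollectI allI)
    fix i
    show "if i \<in> I then (x - axis j (x $ j)) $ i \<in> S else (x - axis j (x $ j)) $ i = 0"
      using that assms by (cases "i = j") (auto simp: grid_def axis_def dest: spec[of _ i])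
  qed
  moreover have "x $ j \<in> S" if "x \<in> grid (insert j I) S" for x
    using that unfolding grid_def by (auto dest: spec[of _ j])
  ultimately show "(\<lambda>x. (x $ j, x - axis j (x $ j))) ` grid (insert j I) S \<subseteq> S \<times> grid I S"
    by auto
qed auto

lemma sum_grid_insert:
  assumes "j \<notin> I"
  shows "sum \<phi> (grid (insert j I) S) = (\<Sum>s\<in>S. \<Sum>x\<in>grid I S. \<phi> (x + axis j s))"
  using sum.reindex_bij_betw[OF bij_betw_grid_insert[OF assms], of \<phi> S]
  by (simp add: sum.cartesian_product case_prod_beta)

lemma finite_grid:
  fixes S :: "int set"
  assumes "finite S"
  shows "finite (grid (I :: 'd::finite set) S)"
  using finite[of I]
proof (induction I rule: finite_induct)
  case (insert j I)
  then show ?case using assms bij_betw_finite[OF bij_betw_grid_insert] by blast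
qed (simp add: grid_empty)

text \<open>Induction over the coordinates: the induction hypothesis, applied to the slices of
  \<open>f\<close>, \<open>g\<close>, \<open>h\<close> at \<open>v\<close>, \<open>s\<close>,
  \<open>t\<close>, says that the slice norms are dominated by the slice sums of \<open>T\<close>.
  This is what \<open>two_point_ineq\<close> needs in the new coordinate.\<close>

lemma grid_ineq:
  fixes f g h T :: "int ^ 'd \<Rightarrow> real"
  assumes pq: "1 < p" "1 < q" "1 / p + 1 / q = 1" and c: "2 powr (1 / c) = p powr (1 / p) * q powr (1 / q)"
    and fin: "finite S" "finite R" and R: "\<And>v s t. v \<in> {0, 1} \<Longrightarrow> s \<in> S \<Longrightarrow> t \<in> S \<Longrightarrow> v + s + t \<in> R"
    and "\<And>v. 0 \<le> f v" "\<And>x. 0 \<le> g x" "\<And>x. 0 \<le> h x" "\<And>z. 0 \<le> T z"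
    and "\<And>v x y. v \<in> grid I {0, 1} \<Longrightarrow> x \<in> grid I S \<Longrightarrow> y \<in> grid I S \<Longrightarrow> f v * g x * h y \<le> T (v + x + y)"
  shows "(\<Sum>v\<in>grid I {0, 1}. f v powr c) powr (1 / c) * (\<Sum>x\<in>grid I S. g x powr p) powr (1 / p)
      * (\<Sum>x\<in>grid I S. h x powr q) powr (1 / q) \<le> sum T (grid I R)"
  using finite[of I] assms(8-)
proof (induction I arbitrary: f g h T rule: finite_induct)
  case empty
  have "1 \<le> c" using exponent_bounds[OF pq c] by simp
  then show ?case using empty(5)[of 0 0 0] empty(1-4) pq by (simp add: grid_empty powr_powr)
next
  case (insert j I)
  have c0: "c \<noteq> 0" using exponent_bounds[OF pq c] by simp
  define N where "N r \<phi> K s = (\<Sum>x\<in>grid I K. \<phi> (x + axis j s) powr r) powr (1 / r)"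
    for r and \<phi> :: "int ^ 'd \<Rightarrow> real" and K and s :: int
  have N: "N r \<phi> K s powr r = (\<Sum>x\<in>grid I K. \<phi> (x + axis j s) powr r)" if "r \<noteq> 0" for r \<phi> K s
    unfolding N_def using that by (simp add: powr_powr sum_nonneg)
  have "(\<Sum>v\<in>{0, 1}. N c f {0, 1} v powr c) powr (1 / c) * (\<Sum>s\<in>S. N p g S s powr p) powr (1 / p)
      * (\<Sum>s\<in>S. N q h S s powr q) powr (1 / q) \<le> (\<Sum>w\<in>R. \<Sum>z\<in>grid I R. T (z + axis j w))"
  proof (rule two_point_ineq[OF pq c _ fin])
    fix v s t :: int assume vst: "v \<in> {0, 1}" "s \<in> S" "t \<in> S"
    show "v + s + t \<in> R" using R vst .
    show "N c f {0, 1} v * N p g S s * N q h S t \<le> (\<Sum>z\<in>grid I R. T (z + axis j (v + s + t)))"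
      unfolding N_def
    proof (rule insert.IH)
      fix u x y assume "u \<in> grid I {0, 1}" "x \<in> grid I S" "y \<in> grid I S"
      then have "f (u + axis j v) * g (x + axis j s) * h (y + axis j t)
          \<le> T ((u + axis j v) + (x + axis j s) + (y + axis j t))"
        using vst insert.hyps by (intro insert.prems mem_grid_insert)
      also have "(u + axis j v) + (x + axis j s) + (y + axis j t) = u + x + y + axis j (v + s + t)"
        by (simp add: vec_eq_iff axis_def)
      finally show "f (u + axis j v) * g (x + axis j s) * h (y + axis j t) \<le> T (u + x + y + axis j (v + s + t))" .
    qed (use insert.prems in auto)
  qed (use insert.prems in \<open>auto simp: N_def intro: sum_nonneg\<close>)
  \<comment> \<open>The powers of the slice norms add up to the sums over the whole grid, since the
    inner and outer exponents agree.\<close>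
  then show ?case using c0 pq insert.hyps by (simp only: N sum_grid_insert[OF \<open>j \<notin> I\<close>]) (simp add: N)
qed

section \<open>Sup-convolutions, norms and indicators\<close>

lemma sup_conv_props:
  fixes f g :: "int ^ 'd \<Rightarrow> real"
  assumes f: "finitely_supported f" "\<And>x. 0 \<le> f x" and g: "finitely_supported g" "\<And>x. 0 \<le> g x"
  shows sup_conv_upper: "f x * g y \<le> (f \<^bold>* g) (x + y)"
    and sup_conv_nonneg: "0 \<le> (f \<^bold>* g) z"
    and finitely_supported_sup_conv: "finitely_supported (f \<^bold>* g)"
proof -
  \<comment> \<open>A supremum of reals bounds its terms only for a bounded family; the factor
    \<open>f x\<close> leaves finitely many values.\<close>
  have "finite (range (\<lambda>x. f x * g (z - x)))" for z
  proof (rule finite_subset)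
    show "range (\<lambda>x. f x * g (z - x)) \<subseteq> insert 0 ((\<lambda>x. f x * g (z - x)) ` {x. f x \<noteq> 0})" by auto
  qed (use f in \<open>auto simp: finitely_supported_def\<close>)
  then have upper: "f x * g (z - x) \<le> (f \<^bold>* g) z" for x z
    unfolding sup_conv_def by (intro cSUP_upper bdd_above_finite) auto
  from this[of x "x + y"] show "f x * g y \<le> (f \<^bold>* g) (x + y)" by simp
  have "0 \<le> f 0 * g (z - 0)" for z using f g by simp
  with upper[of 0] show "0 \<le> (f \<^bold>* g) z" by (rule order_trans[rotated])
  have "{z. (f \<^bold>* g) z \<noteq> 0} \<subseteq> (\<lambda>(x, y). x + y) ` ({x. f x \<noteq> 0} \<times> {x. g x \<noteq> 0})"
  proof
    fix z assume z: "z \<in> {z. (f \<^bold>* g) z \<noteq> 0}"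
    have "(f \<^bold>* g) z = 0" if "\<forall>x. f x * g (z - x) = 0"
      unfolding sup_conv_def by (simp only: that) simp
    with z obtain x where "f x * g (z - x) \<noteq> 0" by auto
    then show "z \<in> (\<lambda>(x, y). x + y) ` ({x. f x \<noteq> 0} \<times> {x. g x \<noteq> 0})"
      by (intro image_eqI[of _ _ "(x, z - x)"]) auto
  qed
  then show "finitely_supported (f \<^bold>* g)"
    using f(1) g(1) unfolding finitely_supported_def by (auto intro: finite_subset)
qed

lemma lr_norm_eq_sum:
  assumes "finite K" "{x. f x \<noteq> 0} \<subseteq> K" "\<And>x. 0 \<le> f x"
  shows "lr_norm r f = (\<Sum>x\<in>K. f x powr r) powr (1 / r)"
proof -
  have "(\<Sum>\<^sub>\<infinity>x. \<bar>f x\<bar> powr r) = (\<Sum>\<^sub>\<infinity>x\<in>K. f x powr r)"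
    using assms by (intro infsum_cong_neutral) auto
  then show ?thesis using assms(1) unfolding lr_norm_def by simp
qed

lemma finite_subset_grid:
  fixes A :: "(int ^ 'd) set"
  assumes "finite A"
  obtains S where "finite S" "A \<subseteq> grid UNIV S"
proof
  show "finite (\<Union>i. (\<lambda>x. x $ i) ` A)" using assms by auto
  show "A \<subseteq> grid UNIV (\<Union>i. (\<lambda>x. x $ i) ` A)" unfolding grid_def by auto
qed

lemma cube01_eq_grid: "cube01 = grid UNIV {0, 1}"
  unfolding cube01_def grid_def by simp

text \<open>\<open>T\<close> is left arbitrary to serve both claims: the sup-convolution gives the
  norm inequality, the indicator of \<open>V + A + B\<close> the cardinality bound.\<close>

lemma dominating_sum_ineq:
  fixes f g h T :: "int ^ 'd \<Rightarrow> real"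
  assumes pq: "1 < p" "1 < q" "1 / p + 1 / q = 1" and c: "2 powr (1 / c) = p powr (1 / p) * q powr (1 / q)"
    and fs: "{x. f x \<noteq> 0} \<subseteq> cube01" "finitely_supported g" "finitely_supported h" "finitely_supported T"
    and nn: "\<And>v. 0 \<le> f v" "\<And>x. 0 \<le> g x" "\<And>x. 0 \<le> h x" "\<And>z. 0 \<le> T z"
    and dom: "\<And>v x y. f v * g x * h y \<le> T (v + x + y)"
  shows "lr_norm c f * lr_norm p g * lr_norm q h \<le> lr_norm 1 T"
proof -
  have "finite ({x. g x \<noteq> 0} \<union> {x. h x \<noteq> 0})" using fs unfolding finitely_supported_def by simp
  then obtain S where S: "finite S" "{x. g x \<noteq> 0} \<union> {x. h x \<noteq> 0} \<subseteq> grid UNIV S"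
    by (rule finite_subset_grid)
  have "finite {x. T x \<noteq> 0}" using fs unfolding finitely_supported_def by simp
  then obtain R0 where R0: "finite R0" "{x. T x \<noteq> 0} \<subseteq> grid UNIV R0"
    by (rule finite_subset_grid)
  \<comment> \<open>The added sums meet the closure condition of \<open>grid_ineq\<close>; they do
    not change the sum of \<open>T\<close>, whose support already lies in the grid over
    \<open>R0\<close>.\<close>
  define R where "R = R0 \<union> (\<lambda>(v, s, t). v + s + t) ` ({0, 1} \<times> S \<times> S)"
  have R: "finite R" "{x. T x \<noteq> 0} \<subseteq> grid UNIV R" unfolding R_def using R0 S by (auto simp: grid_def)
  have "v + s + t \<in> R" if "v \<in> {0, 1}" "s \<in> S" "t \<in> S" for v s t
    unfolding R_def using that by force
  then have "(\<Sum>v\<in>grid UNIV {0, 1}. f v powr c) powr (1 / c) * (\<Sum>x\<in>grid UNIV S. g x powr p) powr (1 / p)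
      * (\<Sum>x\<in>grid UNIV S. h x powr q) powr (1 / q) \<le> sum T (grid UNIV R)"
    using S(1) R(1) nn dom by (intro grid_ineq[OF pq c])
  moreover have "lr_norm c f = (\<Sum>v\<in>grid UNIV {0, 1}. f v powr c) powr (1 / c)"
    using fs nn unfolding cube01_eq_grid by (intro lr_norm_eq_sum finite_grid) auto
  moreover have "lr_norm p g = (\<Sum>x\<in>grid UNIV S. g x powr p) powr (1 / p)"
    "lr_norm q h = (\<Sum>x\<in>grid UNIV S. h x powr q) powr (1 / q)"
    using S nn by (intro lr_norm_eq_sum finite_grid; auto)+
  moreover have "lr_norm 1 T = sum T (grid UNIV R)"
    using lr_norm_eq_sum[OF finite_grid R(2) nn(4), of 1] R(1) nn(4) by (simp add: sum_nonneg)
  ultimately show ?thesis by simp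
qed

lemma lr_norm_indicator:
  assumes "finite A"
  shows "lr_norm r (indicator A) = real (card A) powr (1 / r)"
proof -
  have "lr_norm r (indicator A) = (\<Sum>x\<in>A. indicator A x powr r) powr (1 / r)"
    using assms by (intro lr_norm_eq_sum) (auto simp: indicator_def)
  then show ?thesis by simp
qed

theorem theorem1p3:
  fixes p q c :: real
  assumes "1 < p"
    and "q = p / (p - 1)"
    and "2 powr (1 / c) = p powr (1 / p) * q powr (1 / q)"
  shows "(\<forall>(f :: int ^ 'd \<Rightarrow> real) g h.
            finitely_supported f \<and> finitely_supported g \<and> finitely_supported h \<and>
            (\<forall>x. 0 \<le> f x) \<and> (\<forall>x. 0 \<le> g x) \<and> (\<forall>x. 0 \<le> h x) \<and>
            {x. f x \<noteq> 0} \<subseteq> cube01 \<longrightarrow>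
            lr_norm 1 (f \<^bold>* g \<^bold>* h) \<ge> lr_norm c f * lr_norm p g * lr_norm q h)
       \<and> (\<forall>(A :: (int ^ 'd) set) B V.
            finite A \<and> finite B \<and> V \<subseteq> cube01 \<longrightarrow>
            real (card (V + A + B)) \<ge>
              real (card V) powr (1 / c) * real (card A) powr (1 / p) * real (card B) powr (1 / q))"
proof -
  have pq: "1 < q" "1 / p + 1 / q = 1" using assms(1,2) 
    by (simp_all add: less_divide_eq diff_divide_distrib)
  note ineq = dominating_sum_ineq[OF assms(1) pq assms(3)]
  have "lr_norm c f * lr_norm p g * lr_norm q h \<le> lr_norm 1 (f \<^bold>* g \<^bold>* h)"
    if f: "finitely_supported f" "\<And>x. 0 \<le> f x" "{x. f x \<noteq> 0} \<subseteq> cube01"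
      and g: "finitely_supported g" "\<And>x. 0 \<le> g x" and h: "finitely_supported h" "\<And>x. 0 \<le> h x"
    for f g h :: "int ^ 'd \<Rightarrow> real"
  proof (rule ineq)
    note fg = sup_conv_nonneg[OF f(1,2) g] finitely_supported_sup_conv[OF f(1,2) g]
    show "0 \<le> (f \<^bold>* g \<^bold>* h) z" "finitely_supported (f \<^bold>* g \<^bold>* h)" for z
      by (rule sup_conv_nonneg[OF fg(2,1) h] finitely_supported_sup_conv[OF fg(2,1) h])+
    fix v x y
    have "f v * g x * h y \<le> (f \<^bold>* g) (v + x) * h y"
      using sup_conv_upper[OF f(1,2) g] h by (intro mult_right_mono)
    also have "\<dots> \<le> (f \<^bold>* g \<^bold>* h) (v + x + y)"
      by (rule sup_conv_upper[OF fg(2,1) h])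
    finally show "f v * g x * h y \<le> (f \<^bold>* g \<^bold>* h) (v + x + y)" .
  qed (use that in auto)
  moreover have "real (card V) powr (1 / c) * real (card A) powr (1 / p) * real (card B) powr (1 / q)
      \<le> real (card (V + A + B))"
    if AB: "finite A" "finite B" and V: "V \<subseteq> cube01" for A B V :: "(int ^ 'd) set"
  proof -
    have "finite V" using V finite_grid[of "{0, 1}" UNIV] finite_subset unfolding cube01_eq_grid by blast
    then have fin: "finite (V + A + B)" using AB by (intro finite_set_plus)
    \<comment> \<open>Domination holds because three nonzero indicators place
      \<open>v + x + y\<close> in \<open>V + A + B\<close>.\<close>
    have "lr_norm c (indicator V) * lr_norm p (indicator A) * lr_norm q (indicator B)
        \<le> lr_norm 1 (indicator (V + A + B) :: int ^ 'd \<Rightarrow> real)"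
      using fin AB V
      by (intro ineq) (auto simp: finitely_supported_def indicator_def intro: set_plus_intro)
    then show ?thesis using fin AB \<open>finite V\<close> by (simp add: lr_norm_indicator)
  qed
  ultimately show ?thesis by blast
qed

end
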